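(* Let $r<m$ be positive integers and let $M\in\mathcal{M}_{r,m}(\mathbb{Z})$ be admissible. Then $t(n)=n^{-1/c(M)}$ is a threshold function for the property "$\mathcal{A}$ contains a non-trivial solution of $M\cdot\mathbf{x}=\mathbf{0}$", where $\mathcal{A}$ is drawn from $[n]_p$. That is: if $p=o(n^{-1/c(M)})$ then $\mathbb{P}(\mathcal{A}^m \text{ contains a non-trivial solution of } M\cdot\mathbf{x}=\mathbf{0})\to 0$ as $n\to\infty$, and if $p=\omega(n^{-1/c(M)})$ then this probability tends to $1$.
   Context: Random model: $[n]=\{1,\dots,n\}$; for $p=p(n)\in[0,1]$, $[n]_p$ denotes the random subset $\mathcal{A}\subseteq[n]$ in which each element is included independently with probability $p$. $\mathcal{A}$ contains a solution of $M\cdot\mathbf{x}=\mathbf{0}$ if there is $\mathbf{x}=(x_1,\dots,x_m)^T\in\mathcal{A}^m$ with $M\mathbf{x}=\mathbf{0}$. A matrix $M\in\mathcal{M}_{r,m}(\mathbb{Z})$ (with $r<m$) is admissible if (1) (positivity) $M\mathbf{x}=\mathbf{0}$ has a solution with all entries positive; (2) (irredundancy) for every $i\neq j$ there is a solution $\mathbf{x}$ with $x_i\neq x_j$; (3) (non-degeneracy) $M$ has rank $r$. Trivial solutions: for a solution $\mathbf{x}$, let $\mathfrak{p}(\mathbf{x})$ be the set partition of $\{1,\dots,m\}$ whose blocks are the classes of indices $i$ with equal $x_i$. For a set partition $\mathfrak{p}$ of $\{1,\dots,m\}$, $M_{\mathfrak{p}}\in\mathcal{M}_{r,|\mathfrak{p}|}(\mathbb{Z})$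 is the matrix obtained from $M$ by replacing, for each block, the columns indexed by that block by their sum. A solution $\mathbf{x}$ is trivial if $\mathrm{rk}(M_{\mathfrak{p}(\mathbf{x})})<r$, and non-trivial otherwise. The parameter $c(M)$: for $Q\subseteq\{1,\dots,m\}$ let $\bar Q=\{1,\dots,m\}\setminus Q$, let $M^{\bar Q}$ be the submatrix of $M$ consisting of the columns indexed by $\bar Q$ (with the empty matrix having rank $0$), and let $r_Q=r-\mathrm{rk}(M^{\bar Q})$. Then $c(M)=\max_{\emptyset\neq Q\subseteq\{1,\dots,m\}} \frac{|Q|}{|Q|-r_Q}$. *)

theory Defs
  imports "Jordan_Normal_Form.DL_Rank" "Jordan_Normal_Form.DL_Submatrix"
    "HOL-Library.Landau_Symbols"
begin

definition mrank :: "int mat \<Rightarrow> nat" where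
  "mrank M = vec_space.rank (dim_row M) (map_mat rat_of_int M)"

definition is_solution :: "int mat \<Rightarrow> int vec \<Rightarrow> bool" where
  "is_solution M x \<longleftrightarrow> dim_vec x = dim_col M \<and> M *\<^sub>v x = 0\<^sub>v (dim_row M)"

definition admissible :: "int mat \<Rightarrow> bool" where
  "admissible M \<longleftrightarrow>
     (\<exists>x. is_solution M x \<and> (\<forall>i<dim_col M. x $ i > 0)) \<and>
     (\<forall>i<dim_col M. \<forall>j<dim_col M. i \<noteq> j \<longrightarrow> (\<exists>x. is_solution M x \<and> x $ i \<noteq> x $ j)) \<and>
     mrank M = dim_row M"

definition part_of :: "int vec \<Rightarrow> nat set set" where
  "part_of x = (\<lambda>i. {j. j < dim_vec x \<and> x $ j = x $ i}) ` {..<dim_vec x}"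

text \<open>M_P: for each block of the partition P (blocks ordered by their least element),
  the columns indexed by the block are replaced by their sum.\<close>
definition collapse :: "int mat \<Rightarrow> nat set set \<Rightarrow> int mat" where
  "collapse M P = mat (dim_row M) (card P)
     (\<lambda>(i,k). \<Sum>j \<in> (THE B. B \<in> P \<and> Min B = sorted_list_of_set (Min ` P) ! k). M $$ (i,j))"

definition nontrivial_solution :: "int mat \<Rightarrow> int vec \<Rightarrow> bool" where
  "nontrivial_solution M x \<longleftrightarrow> is_solution M x \<and> \<not> (mrank (collapse M (part_of x)) < mrank M)"

definition contains_nontrivial :: "int mat \<Rightarrow> int set \<Rightarrow> bool" where
  "contains_nontrivial M A \<longleftrightarrow> (\<exists>x. nontrivial_solution M x \<and> (\<forall>i<dim_col M. x $ i \<in> A))"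

definition r_Q :: "int mat \<Rightarrow> nat set \<Rightarrow> int" where
  "r_Q M Q = int (dim_row M) - int (mrank (submatrix M UNIV ({..<dim_col M} - Q)))"

definition cM :: "int mat \<Rightarrow> real" where
  "cM M = Max {real (card Q) / (real (card Q) - real_of_int (r_Q M Q)) | Q.
                 Q \<subseteq> {..<dim_col M} \<and> Q \<noteq> {}}"

definition prob_nontrivial :: "int mat \<Rightarrow> nat \<Rightarrow> real \<Rightarrow> real" where
  "prob_nontrivial M n p = (\<Sum>A\<in>Pow {1..int n}.
      if contains_nontrivial M A then p ^ card A * (1 - p) ^ (n - card A) else 0)"

end

theory Submission
  imports Defs "HOL-Library.Function_Algebras" "HOL-Library.FuncSet" "HOL-Library.Disjoint_Sets"
begin

text \<open>
  Write \<open>d(Q) = |Q| - r_Q\<close>, the dimension of the projection of the solution space to the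
  coordinates in \<open>Q\<close>; positivity gives \<open>d(Q) > 0\<close>, and \<open>1 / c(M)\<close> is the minimum of
  \<open>d(Q) / |Q|\<close>. Below the threshold, fix a minimising \<open>Q\<close>. A solution with partition \<open>P\<close> is
  projected to the blocks meeting \<open>Q\<close>, say \<open>k\<close> of them. The columns of the collapsed matrix at the
  other blocks lie in the span of the columns of \<open>M\<close> outside \<open>Q\<close>, so if the collapsed matrix still
  has rank \<open>r\<close>, there are at most \<open>n^(k - r_Q)\<close> projections, and since \<open>k \<le> |Q|\<close> the expected
  number of those inside the random set tends to 0. Above the threshold, irredundancy and positivity
  yield a positive solution with distinct entries, hence of the order of \<open>n^(m - r)\<close> such solutions
  in \<open>[n]\<close>, and Chebyshev's inequality applies: for each \<open>x\<close>, at most \<open>n^(m - r - d(Q))\<close> solutions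
  have prescribed common entries with \<open>x\<close> at the positions \<open>Q\<close>, and \<open>n^d(Q) p^|Q|\<close> tends to
  infinity.
\<close>

section \<open>Rank of integer matrices and counting in boxes\<close>

lemma (in vector_space) independent_modulo_exists:
  assumes "finite I" "finite W"
  obtains J where "J \<subseteq> I" "card J + dim W = dim (W \<union> v ` I)"
    "\<And>c. (\<Sum>j\<in>J. scale (c j) (v j)) \<in> span W \<Longrightarrow> \<forall>j\<in>J. c j = 0"
    "W \<union> v ` I \<subseteq> span (W \<union> v ` J)"
proof -
  obtain B0 where B0: "B0 \<subseteq> W" "independent B0" "W \<subseteq> span B0" "card B0 = dim W"
    using basis_exists by blast
  obtain B where B: "B0 \<subseteq> B" "B \<subseteq> W \<union> v ` I" "independent B" "W \<union> v ` I \<subseteq> span B"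
    using maximal_independent_subset_extend[of B0 "W \<union> v ` I"] B0 by blast
  have finB: "finite B" using B(2) assms finite_subset by blast
  have cardB: "card B = dim (W \<union> v ` I)" using basis_card_eq_dim B by blast
  have disj: "x \<notin> W" if "x \<in> B - B0" for x
  proof
    assume "x \<in> W"
    then have "x \<in> span B0" using B0 by blast
    moreover have "B0 \<subseteq> B - {x}" using that B(1) by blast
    ultimately have "x \<in> span (B - {x})" using span_mono by blast
    then show False using B(3) that unfolding dependent_def by blast
  qed
  then have "B - B0 \<subseteq> v ` I" using B(2) by blast
  then obtain J where J: "J \<subseteq> I" "inj_on v J" "B - B0 = v ` J"
    using subset_image_inj by metis
  have cJ: "card J = card (B - B0)" using J card_image by metis
  have "card J + dim W = dim (W \<union> v ` I)"
    using cJ cardB B0(4) B(1) finB card_Diff_subset[of B0 B] card_mono[of B B0] finite_subset by fastforce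
  moreover have "\<forall>j\<in>J. c j = 0" if sp: "(\<Sum>j\<in>J. scale (c j) (v j)) \<in> span W" for c
  proof -
    define c' where "c' = (\<lambda>b. c (the_inv_into J v b))"
    have eq: "(\<Sum>j\<in>J. scale (c j) (v j)) = (\<Sum>b\<in>B-B0. scale (c' b) b)"
      unfolding J(3) by (subst sum.reindex[OF J(2)]) (auto intro!: sum.cong simp: c'_def the_inv_into_f_f J(2))
    have "span W \<subseteq> span B0" using B0(3) span_minimal subspace_span by blast
    then have "(\<Sum>b\<in>B-B0. scale (c' b) b) \<in> span B0" using sp eq by auto
    then obtain d where d: "(\<Sum>b\<in>B-B0. scale (c' b) b) = (\<Sum>b\<in>B0. scale (d b) b)"
      using span_finite[of B0] finB B(1) finite_subset by (metis (no_types, lifting) imageE)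
    \<comment> \<open>With the part in \<open>W\<close> moved to the other side, \<open>u\<close> is
      a vanishing combination of the basis \<open>B\<close>.\<close>
    define u where "u = (\<lambda>b. if b \<in> B0 then - d b else c' b)"
    have "(\<Sum>b\<in>B. scale (u b) b) = (\<Sum>b\<in>B-B0. scale (u b) b) + (\<Sum>b\<in>B0. scale (u b) b)"
      by (rule sum.subset_diff) (use B finB in auto)
    also have "(\<Sum>b\<in>B-B0. scale (u b) b) = (\<Sum>b\<in>B-B0. scale (c' b) b)"
      by (rule sum.cong) (auto simp: u_def)
    also have "(\<Sum>b\<in>B0. scale (u b) b) = - (\<Sum>b\<in>B0. scale (d b) b)"
      unfolding sum_negf[symmetric] by (rule sum.cong) (auto simp: u_def)
    finally have "(\<Sum>b\<in>B. scale (u b) b) = 0" using d by simp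
    then have z: "u b = 0" if "b \<in> B" for b
      using independentD[OF B(3) finB] that by blast
    show ?thesis
    proof
      fix j assume "j \<in> J"
      then have "v j \<in> B - B0" using J by blast
      then have "c' (v j) = 0" using z[of "v j"] by (simp add: u_def)
      then show "c j = 0" using \<open>j \<in> J\<close> J(2) by (simp add: c'_def the_inv_into_f_f)
    qed
  qed
  moreover have "W \<union> v ` I \<subseteq> span (W \<union> v ` J)"
  proof -
    have "B \<subseteq> W \<union> v ` J" using J(3) B0(1) by blast
    then show ?thesis using B(4) span_mono by blast
  qed
  ultimately show thesis using that J(1) by blast
qed

section \<open>Matrix rank as the dimension of a set of padded columns\<close>

text \<open>Columns are padded with zeros to functions, so that columns of matrices of any height
  live in one vector space type.\<close>

definition fscale :: "rat \<Rightarrow> (nat \<Rightarrow> rat) \<Rightarrow> nat \<Rightarrow> rat" (infixr "*f" 75) where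
  "c *f f = (\<lambda>i. c * f i)"

lemma fscale_apply [simp]: "(c *f f) i = c * f i"
  by (simp add: fscale_def)

interpretation fs: vector_space fscale
  by unfold_locales (auto simp: fun_eq_iff algebra_simps)

lemma sum_fun_apply: "(\<Sum>x\<in>A. f x) i = (\<Sum>x\<in>A. f x i)"
  by (induction A rule: infinite_finite_induct) auto

definition fun_of_vec :: "rat vec \<Rightarrow> nat \<Rightarrow> rat" where
  "fun_of_vec v = (\<lambda>i. if i < dim_vec v then v $ i else 0)"

lemma inj_on_fun_of_vec: "inj_on fun_of_vec (carrier_vec n)"
proof (rule inj_onI)
  fix x y :: "rat vec" assume *: "x \<in> carrier_vec n" "y \<in> carrier_vec n" "fun_of_vec x = fun_of_vec y"
  then show "x = y"
    by (intro eq_vecI) (auto simp: fun_of_vec_def fun_eq_iff, metis)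
qed

text \<open>Bridges the carrier-based vectors of \<open>vec_space\<close> and the type-based space
  \<open>fs\<close>. Entries beyond \<open>n\<close> are padding zeros, so both sides amount to the
  same \<open>n\<close> scalar equations.\<close>

lemma lincomb_eq_0_iff:
  fixes T :: "rat vec set"
  assumes "finite T" "T \<subseteq> carrier_vec n"
  shows "module.lincomb (module_vec TYPE(rat) n) a T = 0\<^sub>v n \<longleftrightarrow> (\<Sum>x\<in>T. a x *f fun_of_vec x) = 0"
proof -
  interpret V: vec_space "TYPE(rat)" n .
  have "V.lincomb a T = 0\<^sub>v n \<longleftrightarrow> (\<forall>i<n. V.lincomb a T $ i = 0)"
    using V.lincomb_dim[OF assms] by (auto intro!: eq_vecI)
  also have "\<dots> \<longleftrightarrow> (\<forall>i<n. (\<Sum>x\<in>T. a x * x $ i) = 0)"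
    using V.lincomb_index assms(2) by auto
  also have "\<dots> \<longleftrightarrow> (\<forall>i. (\<Sum>x\<in>T. a x * fun_of_vec x i) = 0)"
  proof -
    have "(\<Sum>x\<in>T. a x * fun_of_vec x i) = (if i < n then (\<Sum>x\<in>T. a x * x $ i) else 0)" for i
    proof -
      have "\<And>x. x \<in> T \<Longrightarrow> dim_vec x = n" using assms(2) by auto
      then show ?thesis by (auto simp: fun_of_vec_def intro!: sum.cong sum.neutral)
    qed
    then show ?thesis by auto
  qed
  also have "\<dots> \<longleftrightarrow> (\<Sum>x\<in>T. a x *f fun_of_vec x) = 0"
    by (simp add: fun_eq_iff sum_fun_apply)
  finally show ?thesis .
qed

lemma lin_dep_iff_dependent:
  fixes T :: "rat vec set"
  assumes "finite T" "T \<subseteq> carrier_vec n"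
  shows "module.lin_dep class_ring (module_vec TYPE(rat) n) T \<longleftrightarrow> fs.dependent (fun_of_vec ` T)"
proof -
  interpret V: vec_space "TYPE(rat)" n .
  have inj: "inj_on fun_of_vec T" using inj_on_fun_of_vec assms(2) inj_on_subset by blast
  show ?thesis
  proof
    assume "V.lin_dep T"
    then obtain A a w where A: "finite A" "A \<subseteq> T" "V.lincomb a A = 0\<^sub>v n" "w \<in> A" "a w \<noteq> 0"
      unfolding V.lin_dep_def by auto
    have injA: "inj_on fun_of_vec A" using inj A(2) inj_on_subset by blast
    define u where "u = (\<lambda>b. a (the_inv_into A fun_of_vec b))"
    have "(\<Sum>b\<in>fun_of_vec ` A. u b *f b) = (\<Sum>x\<in>A. a x *f fun_of_vec x)"
      by (subst sum.reindex[OF injA]) (auto intro!: sum.cong simp: u_def the_inv_into_f_f injA)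
    also have "\<dots> = 0" using lincomb_eq_0_iff[of A n a] A assms(2) by blast
    finally have "(\<Sum>b\<in>fun_of_vec ` A. u b *f b) = 0" .
    moreover have "u (fun_of_vec w) \<noteq> 0" using A by (simp add: u_def the_inv_into_f_f injA)
    ultimately show "fs.dependent (fun_of_vec ` T)"
      unfolding fs.dependent_explicit using A by (intro exI[of _ "fun_of_vec ` A"]) blast
  next
    assume "fs.dependent (fun_of_vec ` T)"
    then obtain S u where S: "finite S" "S \<subseteq> fun_of_vec ` T" "\<exists>v\<in>S. u v \<noteq> 0" "(\<Sum>v\<in>S. u v *f v) = 0"
      unfolding fs.dependent_explicit by blast
    obtain A where A: "A \<subseteq> T" "S = fun_of_vec ` A" "inj_on fun_of_vec A"
      using S(2) subset_image_inj by metis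
    have "(\<Sum>x\<in>A. (u \<circ> fun_of_vec) x *f fun_of_vec x) = 0"
      using S(4) unfolding A(2) by (subst (asm) sum.reindex[OF A(3)]) (simp add: o_def)
    then have "V.lincomb (u \<circ> fun_of_vec) A = 0\<^sub>v n"
      using lincomb_eq_0_iff[of A n] A(1) assms finite_subset by blast
    moreover have "\<exists>w\<in>A. (u \<circ> fun_of_vec) w \<noteq> 0" using S(3) A(2) by auto
    moreover have "finite A" using A(1) assms(1) finite_subset by blast
    ultimately show "V.lin_dep T"
      unfolding V.lin_dep_def using A(1) by (intro exI[of _ A] exI[of _ "u \<circ> fun_of_vec"]) auto
  qed
qed

text \<open>The rank is the size of a maximal independent set \<open>S\<close> of columns. Padding
  keeps \<open>S\<close> independent, and by maximality its image spans all columns, so it is a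
  basis on the type-based side.\<close>

lemma rank_eq_dim:
  assumes "A \<in> carrier_mat n nc"
  shows "vec_space.rank n A = fs.dim (fun_of_vec ` set (cols A))"
proof -
  interpret V: vec_space "TYPE(rat)" n .
  let ?C = "set (cols A)"
  have C: "?C \<subseteq> carrier_vec n" using assms cols_dim by blast
  obtain S where S: "maximal S (\<lambda>T. T \<subseteq> ?C \<and> V.lin_indpt T)"
    using maximal_exists_superset[of ?C "\<lambda>T. T \<subseteq> ?C \<and> V.lin_indpt T" "{}"]
    by (metis (no_types, lifting) List.finite_set V.finite_lin_indpt2 empty_iff empty_subsetI finite.emptyI)
  have SC: "S \<subseteq> ?C" and ind: "V.lin_indpt S" using S unfolding maximal_def by auto
  have fS: "finite S" using SC finite_subset by blast
  have i: "fs.independent (fun_of_vec ` S)"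
    using lin_dep_iff_dependent[of S n] fS SC C ind by blast
  have "fun_of_vec c \<in> fs.span (fun_of_vec ` S)" if c: "c \<in> ?C" for c
  proof (rule ccontr)
    assume n: "fun_of_vec c \<notin> fs.span (fun_of_vec ` S)"
    then have cS: "c \<notin> S" using fs.span_base by blast
    have "fs.independent (fun_of_vec ` insert c S)"
      using n i by (simp add: fs.independent_insertI)
    then have "V.lin_indpt (insert c S)"
      using lin_dep_iff_dependent[of "insert c S" n] fS SC C c by auto
    then show False using S c SC cS unfolding maximal_def by (metis insert_subset insertI1 subset_insertI)
  qed
  then have "card (fun_of_vec ` S) = fs.dim (fun_of_vec ` ?C)"
    using i SC by (intro fs.basis_card_eq_dim) auto
  moreover have "inj_on fun_of_vec S"
    using inj_on_fun_of_vec SC C inj_on_subset by (metis subset_trans)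
  ultimately show ?thesis using V.rank_card_indpt[OF assms S] by (simp add: card_image)
qed

definition colf :: "int mat \<Rightarrow> nat \<Rightarrow> nat \<Rightarrow> rat" where
  "colf M j = (\<lambda>i. if i < dim_row M then of_int (M $$ (i, j)) else 0)"

lemma mrank_eq_dim: "mrank M = fs.dim (colf M ` {..<dim_col M})"
proof -
  have "fun_of_vec (col (map_mat rat_of_int M) j) = colf M j" if "j < dim_col M" for j
    using that by (intro ext) (simp add: fun_of_vec_def colf_def)
  then have "fun_of_vec ` set (cols (map_mat rat_of_int M)) = colf M ` {..<dim_col M}"
    unfolding cols_def set_map set_upt atLeast0LessThan image_image by (intro image_cong) auto
  then show ?thesis
    using rank_eq_dim[of "map_mat rat_of_int M" "dim_row M" "dim_col M"]
    unfolding mrank_def by simp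
qed

lemma mrank_submatrix:
  assumes "J \<subseteq> {..<dim_col M}"
  shows "mrank (submatrix M UNIV J) = fs.dim (colf M ` J)"
proof -
  have J: "{j. j < dim_col M \<and> j \<in> J} = J" using assms by auto
  have "finite J" using assms finite_subset by blast
  have "colf (submatrix M UNIV J) j = colf M (pick J j)" if "j < card J" for j
    using that by (auto simp: colf_def fun_eq_iff dim_submatrix submatrix_index J pick_UNIV)
  then have "colf (submatrix M UNIV J) ` {..<card J} = colf M ` pick J ` {..<card J}"
    unfolding image_image by (intro image_cong) auto
  also have "pick J ` {..<card J} = J"
  proof
    show "pick J ` {..<card J} \<subseteq> J" using pick_in_set_le by blast
    show "J \<subseteq> pick J ` {..<card J}"
    proof
      \<comment> \<open>\<open>pick J\<close> enumerates \<open>J\<close> increasingly, so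
        \<open>x\<close> sits at the position given by the number of smaller elements.\<close>
      fix x assume x: "x \<in> J"
      have "{a \<in> J. a < x} \<subset> J" using x by auto
      then have "card {a \<in> J. a < x} < card J" using \<open>finite J\<close> psubset_card_mono by blast
      then show "x \<in> pick J ` {..<card J}" using pick_card_in_set[OF x]
        by (intro image_eqI[of _ _ "card {a \<in> J. a < x}"]) auto
    qed
  qed
  finally show ?thesis unfolding mrank_eq_dim by (simp add: dim_submatrix J)
qed

text \<open>Disjoint nonempty blocks have distinct minima, so the sorted list of minima enumerates
  the blocks without repetition and the definite description in \<open>collapse\<close> is well
  defined. The order of the columns does not affect the dimension.\<close>

lemma mrank_collapse:
  assumes "finite P" and "\<And>B. B \<in> P \<Longrightarrow> finite B \<and> B \<noteq> {}" and "disjoint P"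
  shows "mrank (collapse M P) = fs.dim ((\<lambda>B. \<Sum>j\<in>B. colf M j) ` P)"
proof -
  let ?l = "sorted_list_of_set (Min ` P)"
  define blk where "blk = (\<lambda>k. THE B. B \<in> P \<and> Min B = ?l ! k)"
  have inj: "inj_on Min P"
  proof (rule inj_onI)
    fix A B assume *: "A \<in> P" "B \<in> P" "Min A = Min B"
    have "Min A \<in> A" "Min B \<in> B" using assms(2) * Min_in by blast+
    then have "Min A \<in> A \<inter> B" using *(3) by simp
    then show "A = B" using assms(3) * unfolding disjoint_def by blast
  qed
  have blkI: "blk k = B" if "B \<in> P" "Min B = ?l ! k" for B k
    unfolding blk_def by (rule the_equality) (use that inj in \<open>metis inj_onD\<close>)+
  have len: "length ?l = card P" by (simp add: card_image inj)
  have sl: "set ?l = Min ` P" using assms(1) by simp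
  have blk: "blk ` {..<card P} = P"
  proof (intro equalityI subsetI)
    fix B assume "B \<in> blk ` {..<card P}"
    then obtain k where k: "k < card P" "B = blk k" by auto
    then have "?l ! k \<in> Min ` P" using sl len nth_mem by metis
    then obtain B' where "B' \<in> P" "Min B' = ?l ! k" by auto
    then show "B \<in> P" using blkI k by auto
  next
    fix B assume B: "B \<in> P"
    then have "Min B \<in> set ?l" using sl by auto
    then obtain k where "k < length ?l" "?l ! k = Min B" by (metis in_set_conv_nth)
    then show "B \<in> blk ` {..<card P}" using blkI[OF B, of k] len by (metis imageI lessThan_iff)
  qed
  have "colf (collapse M P) k = (\<Sum>j\<in>blk k. colf M j)" if "k < card P" for k
    using that by (auto simp: colf_def collapse_def fun_eq_iff sum_fun_apply blk_def)
  then have "colf (collapse M P) ` {..<card P} = (\<lambda>B. \<Sum>j\<in>B. colf M j) ` blk ` {..<card P}"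
    unfolding image_image by (intro image_cong) auto
  then show ?thesis unfolding mrank_eq_dim blk by (simp add: collapse_def)
qed

lemma is_solution_iff:
  "is_solution M x \<longleftrightarrow> dim_vec x = dim_col M \<and>
     (\<Sum>j<dim_col M. rat_of_int (x $ j) *f colf M j) = 0"
proof -
  have "M *\<^sub>v x = 0\<^sub>v (dim_row M) \<longleftrightarrow> (\<forall>i<dim_row M. (\<Sum>j<dim_col M. M $$ (i,j) * x $ j) = 0)"
    if "dim_vec x = dim_col M"
    using that by (auto simp: vec_eq_iff scalar_prod_def lessThan_atLeast0)
  moreover have "(\<Sum>j<dim_col M. rat_of_int (x $ j) *f colf M j) = 0 \<longleftrightarrow>
      (\<forall>i<dim_row M. (\<Sum>j<dim_col M. M $$ (i,j) * x $ j) = 0)"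
  proof -
    have "(\<Sum>j<dim_col M. rat_of_int (x $ j) *f colf M j) i =
       (if i < dim_row M then rat_of_int (\<Sum>j<dim_col M. M $$ (i,j) * x $ j) else 0)" for i
      by (auto simp: sum_fun_apply colf_def mult.commute)
    then show ?thesis by (auto simp: fun_eq_iff simp del: of_int_sum of_int_mult)
  qed
  ultimately show ?thesis unfolding is_solution_def by blast
qed

section \<open>Counting points of a box under linear constraints\<close>

text \<open>Choose \<open>J\<close> independent modulo \<open>W\<close>, with |\<open>J\<close>| the
  gain in dimension; only |\<open>I\<close>| - |\<open>J\<close>| coordinates remain free. Taking
  \<open>W\<close> as the columns of discarded blocks counts projections of solutions; taking
  \<open>W\<close> empty and \<open>u\<close> as the contribution of fixed entries counts extensions
  of a partial solution.\<close>

lemma card_restricted_solutions_le: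
  fixes v :: "'a \<Rightarrow> nat \<Rightarrow> rat"
  assumes "finite I" "finite W" "n > 0"
  shows "real (card {z \<in> I \<rightarrow>\<^sub>E {1..int n}. (\<Sum>i\<in>I. rat_of_int (z i) *f v i) - u \<in> fs.span W})
     \<le> real n powr (real (card I) - (real (fs.dim (W \<union> v ` I)) - real (fs.dim W)))"
proof -
  obtain J where J: "J \<subseteq> I" "card J + fs.dim W = fs.dim (W \<union> v ` I)"
    "\<And>c. (\<Sum>j\<in>J. c j *f v j) \<in> fs.span W \<Longrightarrow> \<forall>j\<in>J. c j = 0"
    using fs.independent_modulo_exists[OF assms(1,2), of v] by metis
  let ?Z = "{z \<in> I \<rightarrow>\<^sub>E {1..int n}. (\<Sum>i\<in>I. rat_of_int (z i) *f v i) - u \<in> fs.span W}"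
  \<comment> \<open>The coordinates outside \<open>J\<close> determine \<open>z\<close>, since \<open>v\<close> is independent modulo \<open>W\<close> on \<open>J\<close>.\<close>
  have "inj_on (\<lambda>z. restrict z (I - J)) ?Z"
  proof (rule inj_onI)
    fix y z assume y: "y \<in> ?Z" and z: "z \<in> ?Z" and e: "restrict y (I - J) = restrict z (I - J)"
    have out: "y i = z i" if "i \<in> I - J" for i using that e by (metis restrict_apply')
    have "((\<Sum>i\<in>I. rat_of_int (y i) *f v i) - u) - ((\<Sum>i\<in>I. rat_of_int (z i) *f v i) - u) \<in> fs.span W"
      by (rule fs.span_diff) (use y z in auto)
    also have "((\<Sum>i\<in>I. rat_of_int (y i) *f v i) - u) - ((\<Sum>i\<in>I. rat_of_int (z i) *f v i) - u)
       = (\<Sum>i\<in>I. rat_of_int (y i - z i) *f v i)"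
      by (simp add: sum_subtractf[symmetric] fs.scale_left_diff_distrib)
    also have "\<dots> = (\<Sum>i\<in>J. rat_of_int (y i - z i) *f v i)"
      by (rule sum.mono_neutral_right) (use assms J out in auto)
    finally have "\<forall>j\<in>J. rat_of_int (y j - z j) = 0" by (rule J(3))
    then have "y i = z i" if "i \<in> I" for i
      using out[of i] that by (metis DiffI eq_iff_diff_eq_0 of_int_eq_0_iff)
    moreover have "y \<in> I \<rightarrow>\<^sub>E {1..int n}" "z \<in> I \<rightarrow>\<^sub>E {1..int n}" using y z by simp_all
    ultimately show "y = z" by (rule PiE_ext[rotated 2])
  qed
  moreover have "(\<lambda>z. restrict z (I - J)) ` ?Z \<subseteq> (I - J) \<rightarrow>\<^sub>E {1..int n}"
    by (auto simp: PiE_iff split: if_splits)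
  moreover have "finite ((I - J) \<rightarrow>\<^sub>E {1..int n})" using assms by (intro finite_PiE) auto
  ultimately have "card ?Z \<le> card ((I - J) \<rightarrow>\<^sub>E {1..int n})" by (rule card_inj_on_le)
  also have "\<dots> = n ^ (card I - card J)"
    using assms J(1) by (simp add: card_PiE card_Diff_subset finite_subset)
  finally have "real (card ?Z) \<le> real (n ^ (card I - card J))" by (rule of_nat_mono)
  also have "\<dots> = real n powr (real (card I - card J))" using assms(3) by (simp add: powr_realpow)
  also have "real (card I - card J) = real (card I) - (real (fs.dim (W \<union> v ` I)) - real (fs.dim W))"
    using J(1,2) card_mono[OF assms(1) J(1)] by linarith
  finally show ?thesis .
qed

section \<open>Below the threshold\<close>

text \<open>The probability that the random subset of [n] equals \<open>A\<close>.\<close>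

definition set_weight :: "nat \<Rightarrow> real \<Rightarrow> int set \<Rightarrow> real" where
  "set_weight n p A = p ^ card A * (1 - p) ^ (n - card A)"

lemma set_weight_nonneg: "0 \<le> p \<Longrightarrow> p \<le> 1 \<Longrightarrow> 0 \<le> set_weight n p A"
  by (simp add: set_weight_def)

lemma prob_nontrivial_eq:
  "prob_nontrivial M n p = (\<Sum>A\<in>Pow {1..int n}. of_bool (contains_nontrivial M A) * set_weight n p A)"
  unfolding prob_nontrivial_def set_weight_def by (intro sum.cong) auto

text \<open>This is the probability that the random set contains \<open>T\<close>. It comes from
  expanding a product over [n] with factor p + 0 at the elements of \<open>T\<close> and p + (1 - p)
  elsewhere: a subset that misses some element of \<open>T\<close> picks up a factor 0.\<close>

lemma sum_set_weight_superset:
  assumes "T \<subseteq> {1..int n}"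
  shows "(\<Sum>A\<in>Pow {1..int n}. of_bool (T \<subseteq> A) * set_weight n p A) = p ^ card T"
proof -
  let ?N = "{1..int n}"
  have fT: "finite T" using assms finite_subset by blast
  let ?g = "\<lambda>x. if x \<in> T then 0 else 1 - p"
  have "(\<Prod>x\<in>?N. p + ?g x) = (\<Prod>x\<in>T. p)"
    by (rule prod.mono_neutral_cong_right) (use assms in auto)
  then have "p ^ card T = (\<Prod>x\<in>?N. p + ?g x)" by simp
  also have "\<dots> = (\<Sum>A\<in>Pow ?N. (\<Prod>x\<in>A. p) * (\<Prod>x\<in>?N-A. ?g x))"
    by (rule prod_add) simp
  also have "\<dots> = (\<Sum>A\<in>Pow ?N. of_bool (T \<subseteq> A) * set_weight n p A)"
  proof (rule sum.cong)
    fix A assume A: "A \<in> Pow ?N"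
    then have fA: "finite A" using finite_subset by blast
    show "(\<Prod>x\<in>A. p) * (\<Prod>x\<in>?N-A. ?g x) = of_bool (T \<subseteq> A) * set_weight n p A"
    proof (cases "T \<subseteq> A")
      case True
      have "(\<Prod>x\<in>?N-A. ?g x) = (\<Prod>x\<in>?N-A. 1 - p)" using True by (intro prod.cong) auto
      also have "\<dots> = (1 - p) ^ (n - card A)" using A fA by (simp add: card_Diff_subset)
      finally show ?thesis using True by (simp add: set_weight_def)
    next
      case False
      then obtain t where "t \<in> T" "t \<notin> A" by blast
      then have "t \<in> ?N - A" "?g t = 0" using assms by auto
      then have "(\<Prod>x\<in>?N-A. ?g x) = 0" by (metis (mono_tags, lifting) finite_Diff finite_atLeastAtMost_int prod_zero)
      then show ?thesis using False by simp
    qed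
  qed simp
  finally show ?thesis by simp
qed

lemma sum_set_weight: "(\<Sum>A\<in>Pow {1..int n}. set_weight n p A) = 1"
  using sum_set_weight_superset[of "{}" n p] by simp

text \<open>Union bound over the events \<open>T i \<subseteq> A\<close>, one of which must occur
  whenever \<open>A\<close> contains a nontrivial solution.\<close>

lemma prob_nontrivial_le_sum:
  assumes "finite I" "0 \<le> p" "p \<le> 1" "\<And>i. i \<in> I \<Longrightarrow> T i \<subseteq> {1..int n}"
    and "\<And>A. A \<subseteq> {1..int n} \<Longrightarrow> contains_nontrivial M A \<Longrightarrow> \<exists>i\<in>I. T i \<subseteq> A"
  shows "prob_nontrivial M n p \<le> (\<Sum>i\<in>I. p ^ card (T i))"
proof -
  have "prob_nontrivial M n p \<le>
      (\<Sum>A\<in>Pow {1..int n}. \<Sum>i\<in>I. of_bool (T i \<subseteq> A) * set_weight n p A)"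
    unfolding prob_nontrivial_eq
  proof (rule sum_mono)
    fix A assume A: "A \<in> Pow {1..int n}"
    have nn: "0 \<le> set_weight n p A" by (rule set_weight_nonneg) fact+
    show "of_bool (contains_nontrivial M A) * set_weight n p A
        \<le> (\<Sum>i\<in>I. of_bool (T i \<subseteq> A) * set_weight n p A)"
    proof (cases "contains_nontrivial M A")
      case True
      then obtain i where i: "i \<in> I" "T i \<subseteq> A" using assms(5) A by blast
      have "of_bool (T i \<subseteq> A) * set_weight n p A \<le> (\<Sum>i\<in>I. of_bool (T i \<subseteq> A) * set_weight n p A)"
        by (rule member_le_sum) (use i assms nn in auto)
      then show ?thesis using True i by simp
    qed (use nn in \<open>auto intro!: sum_nonneg\<close>)
  qed
  also have "\<dots> = (\<Sum>i\<in>I. \<Sum>A\<in>Pow {1..int n}. of_bool (T i \<subseteq> A) * set_weight n p A)"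
    by (rule sum.swap)
  also have "\<dots> = (\<Sum>i\<in>I. p ^ card (T i))"
    by (intro sum.cong) (use assms sum_set_weight_superset in auto)
  finally show ?thesis .
qed

section \<open>The quantities \<open>r_Q\<close> and the exponent \<open>1 / cM M\<close>\<close>

lemma (in vector_space) dim_le_dim:
  assumes "V \<subseteq> span W" "finite W"
  shows "dim V \<le> dim W"
proof -
  obtain B where B: "B \<subseteq> W" "independent B" "W \<subseteq> span B" "card B = dim W"
    using basis_exists by blast
  have "V \<subseteq> span B" using assms(1) B(3) span_minimal subspace_span by blast
  then show ?thesis using dim_le_card[of V B] B assms(2) finite_subset by metis
qed

lemma r_Q_eq:
  "r_Q M Q = int (dim_row M) - int (fs.dim (colf M ` ({..<dim_col M} - Q)))"
  unfolding r_Q_def by (subst mrank_submatrix) auto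

lemma r_Q_nonneg:
  assumes "admissible M"
  shows "0 \<le> r_Q M Q"
proof -
  have "colf M ` ({..<dim_col M} - Q) \<subseteq> fs.span (colf M ` {..<dim_col M})"
    using fs.span_superset[of "colf M ` {..<dim_col M}"] by blast
  then have "fs.dim (colf M ` ({..<dim_col M} - Q)) \<le> mrank M"
    unfolding mrank_eq_dim by (intro fs.dim_le_dim) auto
  then show ?thesis using assms unfolding r_Q_eq admissible_def by simp
qed

text \<open>\<open>r_Q\<close> is the size of a maximal \<open>J \<subseteq> Q\<close> whose columns
  are independent modulo the columns outside \<open>Q\<close>. If \<open>J\<close> were all of
  \<open>Q\<close>, a positive solution would contradict this independence. Hence the denominators
  in \<open>cM\<close> are positive.\<close>

lemma r_Q_less_card:
  assumes "admissible M" "Q \<subseteq> {..<dim_col M}" "Q \<noteq> {}"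
  shows "r_Q M Q < int (card Q)"
proof -
  let ?v = "colf M" and ?R = "{..<dim_col M} - Q"
  have fQ: "finite Q" using assms(2) finite_subset by blast
  obtain J where J: "J \<subseteq> Q" "card J + fs.dim (?v ` ?R) = fs.dim (?v ` ?R \<union> ?v ` Q)"
    "\<And>c. (\<Sum>j\<in>J. c j *f ?v j) \<in> fs.span (?v ` ?R) \<Longrightarrow> \<forall>j\<in>J. c j = 0"
    by (rule fs.independent_modulo_exists[of Q "?v ` ?R" ?v]) (use fQ in auto)
  have "?v ` ?R \<union> ?v ` Q = ?v ` {..<dim_col M}" using assms(2) by blast
  then have "fs.dim (?v ` ?R \<union> ?v ` Q) = dim_row M"
    using assms(1) unfolding admissible_def mrank_eq_dim by simp
  then have r: "r_Q M Q = int (card J)" using J(2) unfolding r_Q_eq by simp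
  have "J \<noteq> Q"
  proof
    assume "J = Q"
    obtain x where x: "is_solution M x" "\<forall>i<dim_col M. x $ i > 0"
      using assms(1) unfolding admissible_def by blast
    have "(\<Sum>j<dim_col M. rat_of_int (x $ j) *f ?v j) =
        (\<Sum>j\<in>?R. rat_of_int (x $ j) *f ?v j) + (\<Sum>j\<in>Q. rat_of_int (x $ j) *f ?v j)"
      by (rule sum.subset_diff) (use assms in auto)
    also have "(\<Sum>j<dim_col M. rat_of_int (x $ j) *f ?v j) = 0"
      using x(1) unfolding is_solution_iff by blast
    finally have "(\<Sum>j\<in>Q. rat_of_int (x $ j) *f ?v j) = - (\<Sum>j\<in>?R. rat_of_int (x $ j) *f ?v j)"
      by (metis add_eq_0_iff)
    also have "\<dots> \<in> fs.span (?v ` ?R)"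
      by (intro fs.span_neg fs.span_sum fs.span_scale fs.span_base) auto
    finally have "\<forall>j\<in>Q. rat_of_int (x $ j) = 0" by (rule J(3)[unfolded \<open>J = Q\<close>])
    then show False using x(2) assms(2,3) by force
  qed
  then have "card J < card Q" using J(1) fQ by (simp add: psubset_card_mono psubset_eq)
  then show ?thesis using r by simp
qed

lemma cM_set_finite:
  "finite {real (card Q) / (real (card Q) - real_of_int (r_Q M Q)) | Q. Q \<subseteq> {..<dim_col M} \<and> Q \<noteq> {}}"
proof -
  have "{real (card Q) / (real (card Q) - real_of_int (r_Q M Q)) | Q. Q \<subseteq> {..<dim_col M} \<and> Q \<noteq> {}}
     \<subseteq> (\<lambda>Q. real (card Q) / (real (card Q) - real_of_int (r_Q M Q))) ` Pow {..<dim_col M}" by auto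
  then show ?thesis using finite_subset by blast
qed

text \<open>Reciprocals turn the maximum into a minimum; the inequality reverses because the
  quotient for \<open>Q\<close> is positive by \<open>r_Q_less_card\<close>.\<close>

lemma inverse_cM_le:
  assumes "admissible M" "Q \<subseteq> {..<dim_col M}" "Q \<noteq> {}"
  shows "1 / cM M \<le> (real (card Q) - real_of_int (r_Q M Q)) / real (card Q)"
proof -
  let ?q = "real (card Q)" and ?R = "real_of_int (r_Q M Q)"
  have "card Q > 0" using assms finite_subset by (metis card_gt_0_iff finite_lessThan)
  moreover have "?R < ?q" using r_Q_less_card[OF assms] by linarith
  ultimately have pos: "0 < ?q / (?q - ?R)" by simp
  have "?q / (?q - ?R) \<le> cM M"
    unfolding cM_def by (rule Max_ge[OF cM_set_finite]) (use assms in auto)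
  then have "1 / cM M \<le> 1 / (?q / (?q - ?R))" using pos by (intro frac_le) auto
  then show ?thesis by simp
qed

lemma inverse_cM_attained:
  assumes "dim_col M > 0"
  obtains Q where "Q \<subseteq> {..<dim_col M}" "Q \<noteq> {}"
    "1 / cM M = (real (card Q) - real_of_int (r_Q M Q)) / real (card Q)"
proof -
  let ?S = "{real (card Q) / (real (card Q) - real_of_int (r_Q M Q)) | Q. Q \<subseteq> {..<dim_col M} \<and> Q \<noteq> {}}"
  have "?S \<noteq> {}" using assms by blast
  then have "cM M \<in> ?S" unfolding cM_def by (rule Max_in[OF cM_set_finite])
  then show thesis using that by force
qed

section \<open>First moment: projections of solutions to the blocks meeting \<open>Q\<close>\<close>

lemma partition_on_part_of: "partition_on {..<dim_vec x} (part_of x)"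
  by (rule partition_onI) (auto simp: part_of_def disjnt_def)

lemma part_of_constant: "B \<in> part_of x \<Longrightarrow> i \<in> B \<Longrightarrow> j \<in> B \<Longrightarrow> x $ i = x $ j"
  by (auto simp: part_of_def)

lemma part_of_distinct:
  "B \<in> part_of x \<Longrightarrow> C \<in> part_of x \<Longrightarrow> i \<in> B \<Longrightarrow> j \<in> C \<Longrightarrow> x $ i = x $ j \<Longrightarrow> B = C"
  by (auto simp: part_of_def)

text \<open>Union bound over pairs of a partition and a candidate projection to its blocks meeting
  \<open>Q\<close>, rather than over whole solutions, which may be too numerous in
  expectation.\<close>

lemma prob_nontrivial_upper:
  assumes "admissible M" "Q \<subseteq> {..<dim_col M}" "n > 0" "0 \<le> p" "p \<le> 1"
  shows "prob_nontrivial M n p \<le> (\<Sum>P | partition_on {..<dim_col M} P.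
     real n powr (real (card {B \<in> P. B \<inter> Q \<noteq> {}}) - real_of_int (r_Q M Q)) * p ^ card {B \<in> P. B \<inter> Q \<noteq> {}})"
proof -
  let ?m = "dim_col M" and ?v = "colf M"
  \<comment> \<open>\<open>V B\<close> is the collapsed column of block \<open>B\<close>,
    \<open>K P\<close> the blocks meeting \<open>Q\<close>, and \<open>PP\<close> the partitions
    whose collapsed matrix keeps rank at least r.\<close>
  define V where "V = (\<lambda>B. \<Sum>j\<in>B. ?v j)"
  define K where "K = (\<lambda>P. {B \<in> P. B \<inter> Q \<noteq> {}})"
  define PP where "PP = {P. partition_on {..<?m} P \<and> fs.dim (V ` P) \<ge> dim_row M}"
  \<comment> \<open>Values on the blocks in \<open>K P\<close> that extend rationally to the
    discarded blocks. The subtracted 0 fits the form of \<open>card_restricted_solutions_le\<close>;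
    injectivity ensures that exactly |\<open>K P\<close>| elements have to be in the random
    set.\<close>
  define Z where "Z = (\<lambda>P. {z \<in> K P \<rightarrow>\<^sub>E {1..int n}.
     (\<Sum>B\<in>K P. rat_of_int (z B) *f V B) - 0 \<in> fs.span (V ` (P - K P)) \<and> inj_on z (K P)})"
  have finPP: "finite {P. partition_on {..<?m} P}" by (simp add: finitely_many_partition_on)
  have PPsub: "PP \<subseteq> {P. partition_on {..<?m} P}" by (auto simp: PP_def)
  have finP: "finite P" if "P \<in> PP" for P
    using that finite_elements[of "{..<?m}" P] by (simp add: PP_def)
  have finB: "finite B" "B \<noteq> {}" "B \<subseteq> {..<?m}" if "P \<in> PP" "B \<in> P" for P B
    using that partition_onD1[of "{..<?m}" P] partition_onD3[of "{..<?m}" P] finite_subset[of B "{..<?m}"]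
    unfolding PP_def by blast+
  have KP: "K P \<subseteq> P" for P by (auto simp: K_def)
  have finK: "finite (K P)" if "P \<in> PP" for P using finP[OF that] KP finite_subset by blast
  have finZ: "finite (Z P)" if "P \<in> PP" for P
    by (rule finite_subset[of _ "K P \<rightarrow>\<^sub>E {1..int n}"]) (use finK[OF that] in \<open>auto simp: Z_def intro!: finite_PiE\<close>)
  have cardZ: "real (card (Z P)) \<le> real n powr (real (card (K P)) - real_of_int (r_Q M Q))" if P: "P \<in> PP" for P
  proof -
    let ?Z' = "{z \<in> K P \<rightarrow>\<^sub>E {1..int n}. (\<Sum>B\<in>K P. rat_of_int (z B) *f V B) - 0 \<in> fs.span (V ` (P - K P))}"
    have "finite ?Z'"
      by (rule finite_subset[of _ "K P \<rightarrow>\<^sub>E {1..int n}"]) (use finK[OF P] in \<open>auto intro!: finite_PiE\<close>)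
    then have "card (Z P) \<le> card ?Z'" by (rule card_mono) (auto simp: Z_def)
    then have "real (card (Z P)) \<le> real (card ?Z')" by simp
    also have "\<dots> \<le> real n powr (real (card (K P)) -
        (real (fs.dim (V ` (P - K P) \<union> V ` K P)) - real (fs.dim (V ` (P - K P)))))"
      by (rule card_restricted_solutions_le) (use finK[OF P] finP[OF P] assms(3) in auto)
    \<comment> \<open>All collapsed columns together have dimension at least r, and those of the
      discarded blocks lie in the span of the columns of \<open>M\<close> outside \<open>Q\<close>;
      so the gain in dimension is at least \<open>r_Q\<close>.\<close>
    also have "\<dots> \<le> real n powr (real (card (K P)) - real_of_int (r_Q M Q))"
    proof (rule powr_mono)
      have "V ` (P - K P) \<union> V ` K P = V ` P" using KP by blast
      then have 1: "fs.dim (V ` (P - K P) \<union> V ` K P) \<ge> dim_row M" using P by (simp add: PP_def)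
      have "V ` (P - K P) \<subseteq> fs.span (?v ` ({..<?m} - Q))"
      proof clarify
        fix B assume B: "B \<in> P" "B \<notin> K P"
        then have "B \<subseteq> {..<?m} - Q" using finB(3)[OF P B(1)] by (auto simp: K_def)
        then show "V B \<in> fs.span (?v ` ({..<?m} - Q))"
          unfolding V_def by (intro fs.span_sum fs.span_base) auto
      qed
      then have 2: "fs.dim (V ` (P - K P)) \<le> fs.dim (?v ` ({..<?m} - Q))"
        by (rule fs.dim_le_dim) auto
      show "real (card (K P)) -
        (real (fs.dim (V ` (P - K P) \<union> V ` K P)) - real (fs.dim (V ` (P - K P))))
        \<le> real (card (K P)) - real_of_int (r_Q M Q)"
        using 1 2 unfolding r_Q_eq by simp
    qed (use assms(3) in simp)
    finally show ?thesis .
  qed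
  have "prob_nontrivial M n p \<le> (\<Sum>i\<in>Sigma PP Z. p ^ card (snd i ` K (fst i)))"
  proof (rule prob_nontrivial_le_sum)
    show "finite (Sigma PP Z)" using finite_subset[OF PPsub finPP] finZ by blast
    show "snd i ` K (fst i) \<subseteq> {1..int n}" if "i \<in> Sigma PP Z" for i
      using that by (auto simp: Z_def)
    fix A assume A: "A \<subseteq> {1..int n}" "contains_nontrivial M A"
    then obtain x where x: "nontrivial_solution M x" "\<forall>i<?m. x $ i \<in> A"
      unfolding contains_nontrivial_def by blast
    \<comment> \<open>The solution yields the pair of its own partition and its common value on each
      block, read off at the least index of the block.\<close>
    define P where "P = part_of x"
    define z where "z = restrict (\<lambda>B. x $ (Min B)) (K P)"
    have sol: "dim_vec x = ?m" "(\<Sum>j<?m. rat_of_int (x $ j) *f ?v j) = 0"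
      using x(1) unfolding nontrivial_solution_def is_solution_iff by auto
    have part: "partition_on {..<?m} P" using partition_on_part_of[of x] sol(1) by (simp add: P_def)
    have blk: "finite B" "B \<noteq> {}" "B \<subseteq> {..<?m}" if "B \<in> P" for B
      using that part partition_onD1[of "{..<?m}" P] partition_onD3[of "{..<?m}" P] finite_subset[of B "{..<?m}"]
      by blast+
    have Min: "Min B \<in> B" if "B \<in> P" for B using blk[OF that] by (simp add: Min_in)
    have finP': "finite P" using part finite_elements[of "{..<?m}" P] by simp
    have "mrank (collapse M P) = fs.dim (V ` P)"
      unfolding V_def by (rule mrank_collapse) (use finP' blk part partition_onD2 in auto)
    moreover have "mrank M = dim_row M" using assms(1) by (simp add: admissible_def)
    ultimately have PPP: "P \<in> PP"
      using part x(1) by (simp add: PP_def nontrivial_solution_def P_def)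
    have "(\<Sum>j<?m. rat_of_int (x $ j) *f ?v j) = (\<Sum>B\<in>P. \<Sum>j\<in>B. rat_of_int (x $ j) *f ?v j)"
      unfolding partition_onD1[OF part]
      by (subst sum.Union_disjoint) (use blk partition_onD2[OF part] in \<open>auto simp: disjoint_def\<close>)
    also have "\<dots> = (\<Sum>B\<in>P. rat_of_int (x $ Min B) *f V B)"
      unfolding V_def fs.scale_sum_right
      by (intro sum.cong refl) (metis P_def part_of_constant Min)
    also have "\<dots> = (\<Sum>B\<in>P - K P. rat_of_int (x $ Min B) *f V B) + (\<Sum>B\<in>K P. rat_of_int (x $ Min B) *f V B)"
      by (rule sum.subset_diff) (use KP finP' in auto)
    finally have "(\<Sum>B\<in>K P. rat_of_int (x $ Min B) *f V B) = - (\<Sum>B\<in>P - K P. rat_of_int (x $ Min B) *f V B)"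
      unfolding sol(2) by (simp only: add_eq_0_iff[symmetric])
    also have "\<dots> \<in> fs.span (V ` (P - K P))"
      by (intro fs.span_neg fs.span_sum fs.span_scale fs.span_base) auto
    also have "(\<Sum>B\<in>K P. rat_of_int (x $ Min B) *f V B) = (\<Sum>B\<in>K P. rat_of_int (z B) *f V B) - 0"
      by (simp add: z_def cong: sum.cong)
    finally have "(\<Sum>B\<in>K P. rat_of_int (z B) *f V B) - 0 \<in> fs.span (V ` (P - K P))" .
    moreover have img: "x $ Min B \<in> A" if "B \<in> P" for B
      using x(2) Min[OF that] blk(3)[OF that] by blast
    moreover have "inj_on z (K P)"
    proof (rule inj_onI)
      fix B C assume *: "B \<in> K P" "C \<in> K P" "z B = z C"
      then have "B \<in> P" "C \<in> P" "x $ Min B = x $ Min C" using KP[of P] by (auto simp: z_def)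
      then show "B = C" using part_of_distinct[of B x C "Min B" "Min C"] Min by (simp add: P_def)
    qed
    ultimately have "z \<in> Z P" using A(1) KP[of P] by (auto simp: Z_def z_def)
    moreover have "z ` K P \<subseteq> A" using img KP[of P] by (auto simp: z_def)
    ultimately show "\<exists>i\<in>Sigma PP Z. snd i ` K (fst i) \<subseteq> A"
      using PPP by (intro bexI[of _ "(P, z)"]) auto
  qed (use assms in auto)
  also have "\<dots> = (\<Sum>P\<in>PP. \<Sum>z\<in>Z P. p ^ card (K P))"
    by (subst sum.Sigma) (use finite_subset[OF PPsub finPP] finZ in \<open>auto intro!: sum.cong simp: Z_def card_image\<close>)
  also have "\<dots> = (\<Sum>P\<in>PP. real (card (Z P)) * p ^ card (K P))" by simp
  also have "\<dots> \<le> (\<Sum>P\<in>PP. real n powr (real (card (K P)) - real_of_int (r_Q M Q)) * p ^ card (K P))"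
    by (intro sum_mono mult_right_mono cardZ) (use assms in auto)
  also have "\<dots> \<le> (\<Sum>P | partition_on {..<?m} P. real n powr (real (card (K P)) - real_of_int (r_Q M Q)) * p ^ card (K P))"
    by (rule sum_mono2[OF finPP PPsub]) (use assms in auto)
  finally show ?thesis unfolding K_def .
qed

text \<open>Choosing a point of \<open>Q\<close> in each block that meets it is injective, because
  blocks are disjoint.\<close>

lemma card_blocks_meeting:
  assumes "partition_on A P" "Q \<subseteq> A" "finite A" "Q \<noteq> {}"
  shows "0 < card {B \<in> P. B \<inter> Q \<noteq> {}}" "card {B \<in> P. B \<inter> Q \<noteq> {}} \<le> card Q"
proof -
  let ?K = "{B \<in> P. B \<inter> Q \<noteq> {}}"
  have fQ: "finite Q" using assms finite_subset by blast
  have "finite P" using assms(1,3) finite_elements by blast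
  moreover have "?K \<noteq> {}"
  proof -
    obtain i where "i \<in> Q" "i \<in> \<Union>P" using assms(2,4) partition_onD1[OF assms(1)] by blast
    then show ?thesis by auto
  qed
  ultimately show "0 < card ?K" by (simp add: card_gt_0_iff)
  have "\<forall>B\<in>?K. \<exists>i. i \<in> B \<inter> Q" by blast
  then obtain f where f: "\<And>B. B \<in> ?K \<Longrightarrow> f B \<in> B \<inter> Q" by metis
  have "inj_on f ?K"
  proof (rule inj_onI)
    fix B C assume *: "B \<in> ?K" "C \<in> ?K" "f B = f C"
    then have "f B \<in> B \<inter> C" using f by force
    then show "B = C" using * partition_onD2[OF assms(1)] unfolding disjoint_def by blast
  qed
  moreover have "f ` ?K \<subseteq> Q" using f by blast
  ultimately show "card ?K \<le> card Q" using fQ by (rule card_inj_on_le)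
qed

text \<open>At a minimising \<open>Q\<close>, every term of the first moment bound is at most
  \<open>e\<close> once \<open>p n\<close> is at most \<open>e\<close> times the threshold, whatever
  the number k of blocks meeting \<open>Q\<close>.\<close>

lemma tendsto_0_below_threshold:
  assumes "admissible M" "dim_col M > 0" "\<And>n. 0 \<le> p n \<and> p n \<le> 1"
    and "p \<in> o(\<lambda>n. real n powr (- 1 / cM M))"
  shows "(\<lambda>n. prob_nontrivial M n (p n)) \<longlonglongrightarrow> 0"
proof -
  let ?m = "dim_col M"
  obtain Q where Q: "Q \<subseteq> {..<?m}" "Q \<noteq> {}"
    "1 / cM M = (real (card Q) - real_of_int (r_Q M Q)) / real (card Q)"
    using inverse_cM_attained[OF assms(2)] by blast
  define q where "q = card Q"
  define R where "R = real_of_int (r_Q M Q)"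
  \<comment> \<open>The number of terms does not depend on n, so bounding each of them by
    \<open>e\<close> suffices.\<close>
  define N where "N = card {P. partition_on {..<?m} P}"
  have q: "q > 0" using Q(1,2) finite_subset unfolding q_def by (metis card_gt_0_iff finite_lessThan)
  have R: "R \<ge> 0" using r_Q_nonneg[OF assms(1)] by (simp add: R_def)
  have bound: "prob_nontrivial M n (p n) \<le> real N * e"
    if e: "0 < e" "e \<le> 1" and n: "n > 0" "p n \<le> e * real n powr (- 1 / cM M)" for e n
  proof -
    have "real n powr (real k - R) * p n ^ k \<le> e" if k: "0 < k" "k \<le> q" for k
    proof -
      have "p n ^ k \<le> (e * real n powr (- 1 / cM M)) ^ k"
        by (rule power_mono) (use n assms(3) in auto)
      also have "\<dots> = e ^ k * real n powr (real k * (- 1 / cM M))"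
        using n by (simp add: power_mult_distrib powr_power)
      finally have "real n powr (real k - R) * p n ^ k \<le>
          real n powr (real k - R) * (e ^ k * real n powr (real k * (- 1 / cM M)))"
        by (rule mult_left_mono) simp
      also have "\<dots> = e ^ k * real n powr (real k - R + real k * (- 1 / cM M))"
        by (simp only: powr_add mult.left_commute)
      \<comment> \<open>Inserting 1 / c(M) = (q - R) / q leaves an exponent that is nonpositive, as
        R is nonnegative and k is at most q.\<close>
      also have "real k - R + real k * (- 1 / cM M) = - R * (1 - real k / real q)"
      proof -
        have *: "- 1 / cM M = - ((real q - R) / real q)" using Q(3) unfolding q_def R_def by simp
        show ?thesis unfolding * using q by (simp add: field_simps)
      qed
      also have "e ^ k * real n powr (- R * (1 - real k / real q)) \<le> e * 1"
      proof (rule mult_mono)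
        \<comment> \<open>Here k \<ge> 1 matters: some block meets \<open>Q\<close>.\<close>
        show "e ^ k \<le> e" using e k power_decreasing[of 1 k e] by simp
        have "- R * (1 - real k / real q) \<le> 0" using R k q by (simp add: mult_nonneg_nonneg)
        then show "real n powr (- R * (1 - real k / real q)) \<le> 1"
          using n powr_mono[of "- R * (1 - real k / real q)" 0 "real n"] by simp
      qed (use e in auto)
      finally show ?thesis by simp
    qed
    note single = this
    have "prob_nontrivial M n (p n) \<le> (\<Sum>P | partition_on {..<?m} P.
        real n powr (real (card {B \<in> P. B \<inter> Q \<noteq> {}}) - real_of_int (r_Q M Q)) * p n ^ card {B \<in> P. B \<inter> Q \<noteq> {}})"
      by (rule prob_nontrivial_upper) (use assms Q n in auto)
    also have "\<dots> \<le> (\<Sum>P | partition_on {..<?m} P. e)"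
      unfolding R_def[symmetric] using card_blocks_meeting[OF _ Q(1) _ Q(2)] single
      by (intro sum_mono) (simp add: q_def)
    finally have "prob_nontrivial M n (p n) \<le> (\<Sum>P | partition_on {..<?m} P. e)" .
    then show ?thesis by (simp add: N_def)
  qed
  have nonneg: "0 \<le> prob_nontrivial M n (p n)" for n
    unfolding prob_nontrivial_eq using assms(3)[of n] by (intro sum_nonneg mult_nonneg_nonneg set_weight_nonneg) auto
  show ?thesis
  proof (rule LIMSEQ_I)
    fix t :: real assume t: "0 < t"
    \<comment> \<open>Small enough for \<open>real N * e < t\<close>; the minimum with 1 is what
      makes powers of \<open>e\<close> at most \<open>e\<close>.\<close>
    define e where "e = min 1 (t / (2 * (real N + 1)))"
    have e: "0 < e" "e \<le> 1" using t by (auto simp: e_def)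
    have "real N * e \<le> real N * (t / (2 * (real N + 1)))"
      by (rule mult_left_mono) (auto simp: e_def)
    also have "\<dots> < t" using t by (auto simp: field_simps intro!: add_nonneg_pos)
    finally have Ne: "real N * e < t" .
    have "eventually (\<lambda>n. norm (p n) \<le> e * norm (real n powr (- 1 / cM M))) sequentially"
      using landau_o.smallD[OF assms(4) e(1)] .
    then have "eventually (\<lambda>n. norm (prob_nontrivial M n (p n) - 0) < t) sequentially"
      using eventually_gt_at_top[of 0]
    proof eventually_elim
      case (elim n)
      then have "p n \<le> e * real n powr (- 1 / cM M)" using assms(3)[of n] by simp
      then show ?case using bound[OF e elim(2)] Ne nonneg[of n] by simp
    qed
    then show "\<exists>no. \<forall>n\<ge>no. norm (prob_nontrivial M n (p n) - 0) < t"
      by (simp add: eventually_sequentially)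
  qed
qed

section \<open>Solutions with distinct entries\<close>

text \<open>Coefficients indexed by \<open>J\<close> are obtained although \<open>v\<close> may
  repeat: use one representative index for each vector and 0 at the others.\<close>

lemma (in vector_space) span_image_obtain:
  assumes "finite J" "x \<in> span (v ` J)"
  obtains c where "x = (\<Sum>i\<in>J. scale (c i) (v i))"
proof -
  obtain U where U: "U \<subseteq> J" "inj_on v U" "v ` J = v ` U"
    using subset_image_inj[of "v ` J" v J] by blast
  obtain d where "x = (\<Sum>b\<in>v ` U. scale (d b) b)"
    using assms(2) span_finite[of "v ` J"] assms(1) unfolding U(3) by (metis (no_types, lifting) finite_imageI U(3) imageE)
  also have "\<dots> = (\<Sum>i\<in>U. scale (d (v i)) (v i))" by (simp add: sum.reindex U(2))
  also have "\<dots> = (\<Sum>i\<in>J. scale (if i \<in> U then d (v i) else 0) (v i))"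
    by (rule sum.mono_neutral_cong_left) (use U assms(1) in auto)
  finally show thesis by (rule that)
qed

lemma common_denominator:
  fixes c :: "'a \<Rightarrow> rat"
  assumes "finite J"
  shows "\<exists>D::int. D > 0 \<and> (\<forall>i\<in>J. \<exists>k::int. of_int D * c i = of_int k)"
  using assms
proof (induction J rule: finite_induct)
  case (insert x J)
  then obtain D :: int where D: "D > 0" "\<forall>i\<in>J. \<exists>k::int. of_int D * c i = of_int k" by blast
  obtain a b :: int where ab: "b > 0" "c x = of_int a / of_int b"
    by (metis quotient_of_denom_pos quotient_of_div surj_pair)
  show ?case
  proof (rule exI[of _ "D * b"], intro conjI ballI)
    show "0 < D * b" using D(1) ab(1) by simp
    fix i assume "i \<in> insert x J"
    then consider "i = x" | "i \<in> J" by blast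
    then show "\<exists>k::int. of_int (D * b) * c i = of_int k"
    proof cases
      case 1
      then show ?thesis using ab by (intro exI[of _ "D * a"]) simp
    next
      case 2
      then obtain k :: int where "of_int D * c i = of_int k" using D(2) by blast
      then show ?thesis by (intro exI[of _ "b * k"]) (simp add: mult_ac)
    qed
  qed
qed (auto intro!: exI[of _ 1])

section \<open>Integer solutions as functions\<close>

text \<open>Functions replace vectors so that solutions can be added and scaled pointwise without
  dimension side conditions; values from \<open>dim_col M\<close> onwards are irrelevant.\<close>

definition solution_fun :: "int mat \<Rightarrow> (nat \<Rightarrow> int) \<Rightarrow> bool" where
  "solution_fun M x \<longleftrightarrow> (\<Sum>j<dim_col M. rat_of_int (x j) *f colf M j) = 0"

lemma is_solution_iff_solution_fun:
  "is_solution M x \<longleftrightarrow> dim_vec x = dim_col M \<and> solution_fun M (\<lambda>i. x $ i)"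
  by (simp add: is_solution_iff solution_fun_def)

lemma solution_fun_cong:
  "(\<And>j. j < dim_col M \<Longrightarrow> x j = y j) \<Longrightarrow> solution_fun M x = solution_fun M y"
  unfolding solution_fun_def by (metis (mono_tags, lifting) lessThan_iff sum.cong)

lemma solution_fun_add:
  assumes "solution_fun M x" "solution_fun M y"
  shows "solution_fun M (\<lambda>i. x i + y i)"
  using assms unfolding solution_fun_def by (simp add: fs.scale_left_distrib sum.distrib)

lemma solution_fun_scale:
  assumes "solution_fun M x"
  shows "solution_fun M (\<lambda>i. k * x i)"
proof -
  have "(\<Sum>j<dim_col M. rat_of_int (k * x j) *f colf M j) = rat_of_int k *f (\<Sum>j<dim_col M. rat_of_int (x j) *f colf M j)"
    unfolding fs.scale_sum_right by simp
  then show ?thesis using assms unfolding solution_fun_def by simp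
qed

lemma solution_fun_sum:
  assumes "finite I" "\<And>j. j \<in> I \<Longrightarrow> solution_fun M (b j)"
  shows "solution_fun M (\<lambda>i. \<Sum>j\<in>I. a j * b j i)"
  using assms
proof (induction I rule: finite_induct)
  case empty
  then show ?case by (simp add: solution_fun_def)
next
  case (insert x I)
  then show ?case using solution_fun_add[OF solution_fun_scale[of M "b x" "a x"]] by simp
qed

text \<open>For each pair, at most one \<open>K\<close> makes the two values collide: a nonconstant
  linear equation has at most one root, and if y agrees on the pair then z does not. Finitely many
  values are thus excluded.\<close>

lemma large_multiple_separates:
  fixes y z :: "nat \<Rightarrow> int"
  assumes "finite F" "\<And>i j. (i, j) \<in> F \<Longrightarrow> y i \<noteq> y j \<or> z i \<noteq> z j"
  shows "\<exists>K>K0. \<forall>i j. (i, j) \<in> F \<longrightarrow> K * y i + z i \<noteq> K * y j + z j"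
proof -
  define bad where "bad = (\<Union>(i,j)\<in>F. {K. K * y i + z i = K * y j + z j})"
  have "finite {K. K * y i + z i = K * y j + z j}" if "(i, j) \<in> F" for i j
  proof (cases "y i = y j")
    case True
    then show ?thesis using assms(2)[OF that] by simp
  next
    case False
    have "K = (z j - z i) div (y i - y j)" if "K * y i + z i = K * y j + z j" for K
    proof -
      have "K * (y i - y j) = z j - z i" using that by (simp add: algebra_simps)
      then show ?thesis using False by (metis nonzero_mult_div_cancel_right right_minus_eq)
    qed
    then have "{K. K * y i + z i = K * y j + z j} \<subseteq> {(z j - z i) div (y i - y j)}" by blast
    then show ?thesis using finite_subset by blast
  qed
  then have "finite bad" unfolding bad_def using assms(1) by auto
  then have "infinite ({K0<..} - bad)" using infinite_Ioi[of K0] by simp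
  then obtain K where "K \<in> {K0<..} - bad" using infinite_imp_nonempty by blast
  then have "K > K0" "\<forall>i j. (i, j) \<in> F \<longrightarrow> K * y i + z i \<noteq> K * y j + z j"
    unfolding bad_def by auto
  then show ?thesis by blast
qed

text \<open>Irredundancy separates the pairs of indices one after another, each time keeping the
  earlier pairs apart by a suitable multiple. A large multiple of a positive solution is then added
  to gain positivity.\<close>

lemma distinct_positive_solution:
  assumes "admissible M"
  obtains x where "solution_fun M x" "\<And>i. i < dim_col M \<Longrightarrow> x i > 0" "inj_on x {..<dim_col M}"
proof -
  let ?m = "dim_col M"
  let ?F = "{(i, j). i < ?m \<and> j < ?m \<and> i \<noteq> j}"
  have finF: "finite ?F" by (rule finite_subset[of _ "{..<?m} \<times> {..<?m}"]) auto
  have ex: "\<exists>y. solution_fun M y \<and> (\<forall>(i,j)\<in>G. y i \<noteq> y j)" if "finite G" "G \<subseteq> ?F" for G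
    using that
  proof (induction G rule: finite_induct)
    case empty
    show ?case by (intro exI[of _ "\<lambda>_. 0"]) (simp add: solution_fun_def)
  next
    case (insert e G)
    obtain i j where e: "e = (i, j)" by (cases e)
    have ij: "i < ?m" "j < ?m" "i \<noteq> j" using insert.prems e by auto
    obtain y where y: "solution_fun M y" "\<forall>(i,j)\<in>G. y i \<noteq> y j" using insert by blast
    obtain z where z: "is_solution M z" "z $ i \<noteq> z $ j"
      using assms ij unfolding admissible_def by blast
    have "y k \<noteq> y l \<or> z $ k \<noteq> z $ l" if "(k, l) \<in> insert e G" for k l
      using that y(2) z(2) e by blast
    then have "\<exists>K>0. \<forall>i j. (i, j) \<in> insert e G \<longrightarrow> K * y i + z $ i \<noteq> K * y j + z $ j"
      by (intro large_multiple_separates) (use insert.hyps(1) in simp)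
    then obtain K where K: "\<forall>i j. (i, j) \<in> insert e G \<longrightarrow> K * y i + z $ i \<noteq> K * y j + z $ j"
      by blast
    have "solution_fun M (\<lambda>i. K * y i + z $ i)"
      using solution_fun_add[OF solution_fun_scale[OF y(1)]] z(1) by (simp add: is_solution_iff_solution_fun)
    then show ?case using K by blast
  qed
  obtain y where y: "solution_fun M y" "\<forall>(i,j)\<in>?F. y i \<noteq> y j" using ex[OF finF] by blast
  obtain x where x: "is_solution M x" "\<forall>i<?m. x $ i > 0" using assms unfolding admissible_def by blast
  \<comment> \<open>This lower bound on \<open>K\<close> makes \<open>K * x $ i\<close>, at least
    \<open>K\<close>, outweigh a possibly negative \<open>y i\<close>.\<close>
  have "\<exists>K>(\<Sum>i<?m. \<bar>y i\<bar>). \<forall>i j. (i, j) \<in> ?F \<longrightarrow> K * x $ i + y i \<noteq> K * x $ j + y j"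
    by (rule large_multiple_separates[OF finF]) (use y(2) in blast)
  then obtain K where K: "K > (\<Sum>i<?m. \<bar>y i\<bar>)"
    "\<forall>i j. (i, j) \<in> ?F \<longrightarrow> K * x $ i + y i \<noteq> K * x $ j + y j" by blast
  show thesis
  proof (rule that)
    show "solution_fun M (\<lambda>i. K * x $ i + y i)"
      using solution_fun_add[OF solution_fun_scale y(1)] x(1) by (simp add: is_solution_iff_solution_fun)
    show "inj_on (\<lambda>i. K * x $ i + y i) {..<?m}"
      using K(2) by (intro inj_onI) blast
    fix i assume i: "i < ?m"
    have "\<bar>y i\<bar> \<le> (\<Sum>i<?m. \<bar>y i\<bar>)" by (rule member_le_sum) (use i in auto)
    moreover from this have "K \<ge> 0" using K(1) by linarith
    then have "K * 1 \<le> K * x $ i" using x(2) i by (intro mult_left_mono) auto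
    ultimately show "0 < K * x $ i + y i" using K(1) by linarith
  qed
qed

section \<open>A lower bound for the number of solutions with distinct entries\<close>

definition distinct_solutions :: "int mat \<Rightarrow> nat \<Rightarrow> (nat \<Rightarrow> int) set" where
  "distinct_solutions M n = {x \<in> {..<dim_col M} \<rightarrow>\<^sub>E {1..int n}. solution_fun M x \<and> inj_on x {..<dim_col M}}"

lemma finite_distinct_solutions: "finite (distinct_solutions M n)"
  by (rule finite_subset[of _ "{..<dim_col M} \<rightarrow>\<^sub>E {1..int n}"])
    (auto simp: distinct_solutions_def intro!: finite_PiE)

text \<open>\<open>J\<close> indexes a basis of the column space. Each further column is a rational
  combination of that basis, and clearing denominators gives an integer solution. The family is
  diagonal outside \<open>J\<close>, so coefficients of its combinations can be read off
  there.\<close>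

lemma kernel_family:
  assumes "mrank M = dim_row M"
  obtains J b where "J \<subseteq> {..<dim_col M}" "card J = dim_row M"
    "\<And>j. j \<in> {..<dim_col M} - J \<Longrightarrow> solution_fun M (b j) \<and> b j j > 0"
    "\<And>i j. j \<in> {..<dim_col M} - J \<Longrightarrow> i \<in> {..<dim_col M} - J \<Longrightarrow> i \<noteq> j \<Longrightarrow> b j i = 0"
proof -
  let ?I = "{..<dim_col M}" and ?v = "colf M"
  obtain J where J: "J \<subseteq> ?I" "card J + fs.dim {} = fs.dim ({} \<union> ?v ` ?I)"
    "{} \<union> ?v ` ?I \<subseteq> fs.span ({} \<union> ?v ` J)"
    by (rule fs.independent_modulo_exists[of ?I "{}" ?v]) auto
  have finJ: "finite J" using J(1) finite_subset by blast
  have "fs.dim {} = 0" using fs.dim_eq_card_independent[of "{}"] by (simp add: fs.independent_empty)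
  then have cJ: "card J = dim_row M" using J(2) assms by (simp add: mrank_eq_dim)
  have "\<exists>b. solution_fun M b \<and> b j > 0 \<and> (\<forall>i\<in>?I - J. i \<noteq> j \<longrightarrow> b i = 0)" if j: "j \<in> ?I - J" for j
  proof -
    have "?v j \<in> fs.span (?v ` J)" using J(3) j by auto
    then obtain c where c: "?v j = (\<Sum>i\<in>J. c i *f ?v i)" using fs.span_image_obtain[OF finJ] by blast
    obtain D :: int where D: "D > 0" "\<forall>i\<in>J. \<exists>k::int. of_int D * c i = of_int k"
      using common_denominator[OF finJ] by blast
    obtain k where k: "\<And>i. i \<in> J \<Longrightarrow> of_int D * c i = rat_of_int (k i)" using D(2) by metis
    \<comment> \<open>The relation expressing column j in the basis, multiplied by the common
      denominator \<open>D\<close>.\<close>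
    define b where "b = (\<lambda>i. if i = j then D else if i \<in> J then - k i else 0)"
    have "(\<Sum>i<dim_col M. rat_of_int (b i) *f ?v i) = (\<Sum>i\<in>insert j J. rat_of_int (b i) *f ?v i)"
      by (rule sum.mono_neutral_right) (use J(1) j in \<open>auto simp: b_def\<close>)
    also have "\<dots> = rat_of_int D *f ?v j + (\<Sum>i\<in>J. rat_of_int (b i) *f ?v i)"
      using finJ j by (simp add: b_def)
    also have "(\<Sum>i\<in>J. rat_of_int (b i) *f ?v i) = (\<Sum>i\<in>J. - (rat_of_int D *f c i *f ?v i))"
      by (rule sum.cong) (use j k in \<open>auto simp: b_def\<close>)
    also have "\<dots> = - (rat_of_int D *f ?v j)"
      unfolding c fs.scale_sum_right by (simp add: sum_negf)
    finally have "solution_fun M b" unfolding solution_fun_def by (simp only: add.right_inverse)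
    then show ?thesis using D(1) by (intro exI[of _ b]) (auto simp: b_def)
  qed
  then obtain b where "\<And>j. j \<in> ?I - J \<Longrightarrow>
      solution_fun M (b j) \<and> b j j > 0 \<and> (\<forall>i\<in>?I - J. i \<noteq> j \<longrightarrow> b j i = 0)" by metis
  then show thesis using that[OF J(1) cJ] by blast
qed

text \<open>A large multiple of one positive solution with distinct entries is perturbed by small
  combinations of the m - r kernel solutions; all perturbed solutions stay positive and keep
  distinct entries.\<close>

lemma card_distinct_solutions_ge:
  assumes "admissible M"
  obtains C :: nat where "C > 0"
    "\<And>n. n \<ge> C \<Longrightarrow> (real n / real C) ^ (dim_col M - dim_row M) \<le> real (card (distinct_solutions M n))"
proof -
  let ?I = "{..<dim_col M}"
  have "mrank M = dim_row M" using assms by (simp add: admissible_def)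
  then obtain J b where J: "J \<subseteq> ?I" "card J = dim_row M"
    and b: "\<And>j. j \<in> ?I - J \<Longrightarrow> solution_fun M (b j) \<and> b j j > 0"
    and b0: "\<And>i j. j \<in> ?I - J \<Longrightarrow> i \<in> ?I - J \<Longrightarrow> i \<noteq> j \<Longrightarrow> b j i = 0"
    using kernel_family by blast
  obtain x where x: "solution_fun M x" "\<And>i. i < dim_col M \<Longrightarrow> x i > 0" "inj_on x ?I"
    using distinct_positive_solution[OF assms] by blast
  let ?U = "?I - J"
  \<comment> \<open>\<open>B\<close> bounds the sum of |b j i| over j at every position i;
    \<open>C\<close> is such that all entries of the perturbed solutions at scale \<open>K\<close>
    are at most K C.\<close>
  define B where "B = (\<Sum>i\<in>?I. \<Sum>j\<in>?U. \<bar>b j i\<bar>)"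
  define C where "C = nat ((2 * B + 1) * (\<Sum>i\<in>?I. x i) + B + 1)"
  have B: "B \<ge> 0" unfolding B_def by (intro sum_nonneg) auto
  have sx: "(\<Sum>i\<in>?I. x i) \<ge> 0" using x(2) by (intro sum_nonneg) (auto intro: less_imp_le)
  have "0 \<le> (2 * B + 1) * (\<Sum>i\<in>?I. x i)" by (rule mult_nonneg_nonneg) (use B sx in auto)
  then have Cint: "int C = (2 * B + 1) * (\<Sum>i\<in>?I. x i) + B + 1" and C: "C > 0"
    using B unfolding C_def by linarith+
  have "(real n / real C) ^ (dim_col M - dim_row M) \<le> real (card (distinct_solutions M n))" if n: "n \<ge> C" for n
  proof -
    \<comment> \<open>The largest scale with K C \<le> n.\<close>
    define K where "K = n div C"
    have K: "K \<ge> 1" using n C by (simp add: K_def div_greater_zero_iff Suc_leI)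
    \<comment> \<open>The factor K (2 B + 1) is chosen against the perturbation, which is at most K
      B in absolute value: entries remain positive, and a gap of at least K (2 B + 1) between two
      entries shrinks by at most 2 K B.\<close>
    define f where "f = (\<lambda>a. restrict (\<lambda>i. int K * (2 * B + 1) * x i + (\<Sum>j\<in>?U. a j * b j i)) ?I)"
    let ?A = "?U \<rightarrow>\<^sub>E {0..int K}"
    have part: "\<bar>\<Sum>j\<in>?U. a j * b j i\<bar> \<le> int K * B" if a: "a \<in> ?A" and i: "i \<in> ?I" for a i
    proof -
      have "\<bar>\<Sum>j\<in>?U. a j * b j i\<bar> \<le> (\<Sum>j\<in>?U. \<bar>a j * b j i\<bar>)" by (rule sum_abs)
      also have "\<dots> \<le> (\<Sum>j\<in>?U. int K * \<bar>b j i\<bar>)"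
        unfolding abs_mult by (intro sum_mono mult_right_mono) (use a in \<open>auto simp: PiE_iff\<close>)
      also have "\<dots> = int K * (\<Sum>j\<in>?U. \<bar>b j i\<bar>)" by (simp add: sum_distrib_left)
      also have "(\<Sum>j\<in>?U. \<bar>b j i\<bar>) \<le> B"
        unfolding B_def by (rule member_le_sum[of i ?I "\<lambda>i. \<Sum>j\<in>?U. \<bar>b j i\<bar>"]) (use i in \<open>auto intro: sum_nonneg\<close>)
      finally show ?thesis by (simp add: mult_left_mono)
    qed
    have inS: "f a \<in> distinct_solutions M n" if a: "a \<in> ?A" for a
    proof -
      have fi: "f a i = int K * (2 * B + 1) * x i + (\<Sum>j\<in>?U. a j * b j i)" if "i \<in> ?I" for i
        using that by (simp add: f_def)
      have rng: "f a i \<in> {1..int n}" if i: "i \<in> ?I" for i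
      proof -
        have "1 * 1 \<le> int K * (B + 1)" using K B by (intro mult_mono) auto
        also have "\<dots> \<le> int K * (2 * B + 1) * x i - int K * B"
        proof -
          have "int K * (2 * B + 1) * 1 \<le> int K * (2 * B + 1) * x i"
            using x(2)[of i] i B by (intro mult_left_mono) auto
          then show ?thesis by (simp add: algebra_simps)
        qed
        finally have low: "1 \<le> f a i" using part[OF a i] fi[OF i] by linarith
        have "x i \<le> (\<Sum>i\<in>?I. x i)"
          by (rule member_le_sum) (use i x(2) in \<open>auto intro: less_imp_le\<close>)
        then have "int K * (2 * B + 1) * x i \<le> int K * (2 * B + 1) * (\<Sum>i\<in>?I. x i)"
          using B by (intro mult_left_mono) auto
        then have "f a i \<le> int K * (2 * B + 1) * (\<Sum>i\<in>?I. x i) + int K * B"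
          using part[OF a i] fi[OF i] by linarith
        also have "\<dots> \<le> int K * int C" unfolding Cint by (simp add: algebra_simps)
        also have "\<dots> \<le> int n" unfolding K_def by (metis of_nat_mult of_nat_mono div_times_less_eq_dividend)
        finally show ?thesis using low by simp
      qed
      have "inj_on (f a) ?I"
      proof (rule inj_onI, rule ccontr)
        fix i k assume i: "i \<in> ?I" and k: "k \<in> ?I" and eq: "f a i = f a k" and "i \<noteq> k"
        then have "x i \<noteq> x k" using x(3) by (metis inj_onD)
        then have "\<bar>x i - x k\<bar> \<ge> 1" by linarith
        then have "int K * (2 * B + 1) * 1 \<le> int K * (2 * B + 1) * \<bar>x i - x k\<bar>"
          using B by (intro mult_left_mono) auto
        also have "\<dots> = \<bar>int K * (2 * B + 1) * x i - int K * (2 * B + 1) * x k\<bar>"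
          using B by (simp add: abs_mult flip: right_diff_distrib)
        also have "\<dots> \<le> 2 * (int K * B)"
          using eq fi[OF i] fi[OF k] part[OF a i] part[OF a k] by linarith
        finally show False using K by (simp add: algebra_simps)
      qed
      moreover have "solution_fun M (f a)"
      proof -
        have "solution_fun M (\<lambda>i. int K * (2 * B + 1) * x i + (\<Sum>j\<in>?U. a j * b j i))"
          by (intro solution_fun_add solution_fun_scale x(1) solution_fun_sum) (use b in auto)
        then show ?thesis using solution_fun_cong[of M "f a"] fi by (metis (no_types, lifting) lessThan_iff)
      qed
      moreover have "f a \<in> ?I \<rightarrow>\<^sub>E {1..int n}" using rng by (auto simp: f_def)
      ultimately show ?thesis by (simp add: distinct_solutions_def)
    qed
    have "inj_on f ?A"
    proof (rule inj_onI)
      fix a a' assume a: "a \<in> ?A" and a': "a' \<in> ?A" and eq: "f a = f a'"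
      \<comment> \<open>At position i outside \<open>J\<close> only the i-th kernel solution is
        nonzero, so \<open>f a\<close> determines \<open>a i\<close>.\<close>
      have val: "(\<Sum>j\<in>?U. c j * b j i) = c i * b i i" if "i \<in> ?U" for c i
      proof -
        have "(\<Sum>j\<in>?U. c j * b j i) = (\<Sum>j\<in>{i}. c j * b j i)"
          by (rule sum.mono_neutral_right) (use that b0 in auto)
        then show ?thesis by simp
      qed
      have "a i = a' i" if i: "i \<in> ?U" for i
      proof -
        have "f a i = f a' i" using eq by simp
        then have "a i * b i i = a' i * b i i" using i val[OF i] by (simp add: f_def)
        then show ?thesis using b[OF i] by auto
      qed
      then show "a = a'" by (rule PiE_ext[OF a a'])
    qed
    moreover have "f ` ?A \<subseteq> distinct_solutions M n" using inS by blast
    ultimately have "card ?A \<le> card (distinct_solutions M n)"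
      using finite_distinct_solutions by (rule card_inj_on_le)
    moreover have "card ?A = (K + 1) ^ (dim_col M - dim_row M)"
      using J finite_subset[OF J(1)] by (simp add: card_PiE card_Diff_subset nat_add_distrib)
    ultimately have *: "real ((K + 1) ^ (dim_col M - dim_row M)) \<le> real (card (distinct_solutions M n))" by linarith
    have "n \<le> C * (K + 1)"
      unfolding K_def using C by (metis Suc_eq_plus1 dividend_less_times_div less_imp_le mult_Suc_right add.commute)
    then have "real n \<le> real C * real (K + 1)" by (metis of_nat_le_iff of_nat_mult)
    then have "real n / real C \<le> real (K + 1)" using C by (simp add: field_simps)
    then have "(real n / real C) ^ (dim_col M - dim_row M) \<le> real (K + 1) ^ (dim_col M - dim_row M)"
      by (rule power_mono) simp
    then show ?thesis using * by simp
  qed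
  then show thesis using C that by blast
qed

section \<open>Above the threshold\<close>

text \<open>The partition consists of singletons, so collapsing keeps every column and hence the
  rank.\<close>

lemma nontrivial_of_distinct:
  assumes "admissible M" "x \<in> distinct_solutions M n"
  shows "nontrivial_solution M (vec (dim_col M) x)"
proof -
  let ?m = "dim_col M" and ?x = "vec (dim_col M) x"
  have inj: "inj_on x {..<?m}" and sol: "solution_fun M x"
    using assms(2) by (auto simp: distinct_solutions_def)
  have "part_of ?x = (\<lambda>i. {i}) ` {..<?m}"
    unfolding part_of_def using inj by (intro image_cong) (auto dest: inj_onD)
  moreover have "mrank (collapse M ((\<lambda>i. {i}) ` {..<?m})) = mrank M"
    by (subst mrank_collapse) (auto simp: disjoint_def image_image mrank_eq_dim)
  moreover have "solution_fun M (\<lambda>i. ?x $ i)"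
    using sol solution_fun_cong[of M "\<lambda>i. ?x $ i" x] by simp
  ultimately show ?thesis
    unfolding nontrivial_solution_def is_solution_iff_solution_fun by simp
qed

text \<open>Fixing the entries on \<open>Q\<close> leaves an affine system in m - |Q| unknowns of
  rank r - \<open>r_Q\<close>.\<close>

lemma card_distinct_solutions_fibre:
  assumes "Q \<subseteq> {..<dim_col M}" "n > 0"
  shows "real (card {y \<in> distinct_solutions M n. \<forall>j\<in>Q. y j = w j}) \<le>
    real n powr (real (dim_col M) - real (dim_row M) - (real (card Q) - real_of_int (r_Q M Q)))"
proof -
  let ?I = "{..<dim_col M}" and ?v = "colf M"
  let ?u = "- (\<Sum>j\<in>Q. rat_of_int (w j) *f ?v j)"
  let ?Y = "{y \<in> distinct_solutions M n. \<forall>j\<in>Q. y j = w j}"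
  \<comment> \<open>The span of the empty set is 0, so membership in it is the exact equation, with
    the fixed entries contributing \<open>?u\<close>.\<close>
  let ?Z = "{z \<in> (?I - Q) \<rightarrow>\<^sub>E {1..int n}. (\<Sum>i\<in>?I - Q. rat_of_int (z i) *f ?v i) - ?u \<in> fs.span {}}"
  have "inj_on (\<lambda>y. restrict y (?I - Q)) ?Y"
  proof (rule inj_onI)
    fix y z assume y: "y \<in> ?Y" and z: "z \<in> ?Y" and e: "restrict y (?I - Q) = restrict z (?I - Q)"
    have "y i = z i" if "i \<in> ?I" for i
      using that y z fun_cong[OF e, of i] by (cases "i \<in> Q") auto
    moreover have "y \<in> ?I \<rightarrow>\<^sub>E {1..int n}" "z \<in> ?I \<rightarrow>\<^sub>E {1..int n}"
      using y z by (auto simp: distinct_solutions_def)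
    ultimately show "y = z" by (rule PiE_ext[rotated 2])
  qed
  moreover have "(\<lambda>y. restrict y (?I - Q)) ` ?Y \<subseteq> ?Z"
  proof (rule image_subsetI)
    fix y assume "y \<in> ?Y"
    then have y: "y \<in> distinct_solutions M n" "\<forall>j\<in>Q. y j = w j" by simp_all
    have "(\<Sum>j\<in>?I. rat_of_int (y j) *f ?v j)
        = (\<Sum>j\<in>?I - Q. rat_of_int (y j) *f ?v j) + (\<Sum>j\<in>Q. rat_of_int (y j) *f ?v j)"
      by (rule sum.subset_diff) (use assms in auto)
    also have "(\<Sum>j\<in>?I. rat_of_int (y j) *f ?v j) = 0"
      using y(1) by (simp add: distinct_solutions_def solution_fun_def)
    also have "(\<Sum>j\<in>Q. rat_of_int (y j) *f ?v j) = (\<Sum>j\<in>Q. rat_of_int (w j) *f ?v j)"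
      using y(2) by (intro sum.cong) auto
    also have "(\<Sum>j\<in>?I - Q. rat_of_int (y j) *f ?v j)
        = (\<Sum>j\<in>?I - Q. rat_of_int (restrict y (?I - Q) j) *f ?v j)"
      by (intro sum.cong) auto
    finally have "(\<Sum>j\<in>?I - Q. rat_of_int (restrict y (?I - Q) j) *f ?v j) - ?u = 0"
      by (simp only: diff_minus_eq_add)
    then have "(\<Sum>j\<in>?I - Q. rat_of_int (restrict y (?I - Q) j) *f ?v j) - ?u \<in> fs.span {}"
      using fs.span_zero by metis
    moreover have "restrict y (?I - Q) \<in> (?I - Q) \<rightarrow>\<^sub>E {1..int n}"
      using y(1) by (auto simp: distinct_solutions_def)
    ultimately show "restrict y (?I - Q) \<in> ?Z" by blast
  qed
  moreover have "finite ?Z"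
    by (rule finite_subset[of _ "(?I - Q) \<rightarrow>\<^sub>E {1..int n}"]) (auto intro!: finite_PiE)
  ultimately have "card ?Y \<le> card ?Z" by (rule card_inj_on_le)
  then have "real (card ?Y) \<le> real (card ?Z)" by simp
  also have "\<dots> \<le> real n powr (real (card (?I - Q)) - (real (fs.dim ({} \<union> ?v ` (?I - Q))) - real (fs.dim {})))"
    by (rule card_restricted_solutions_le) (use assms in auto)
  also have "real (card (?I - Q)) - (real (fs.dim ({} \<union> ?v ` (?I - Q))) - real (fs.dim {})) =
      real (dim_col M) - real (dim_row M) - (real (card Q) - real_of_int (r_Q M Q))"
  proof -
    have "fs.dim {} = 0" using fs.dim_eq_card_independent[of "{}"] by (simp add: fs.independent_empty)
    moreover have "real (card (?I - Q)) = real (dim_col M) - real (card Q)"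
      using assms(1) card_mono[OF _ assms(1)] finite_subset[OF assms(1)] by (simp add: card_Diff_subset of_nat_diff)
    ultimately show ?thesis unfolding r_Q_eq by simp
  qed
  finally show ?thesis .
qed

section \<open>Second moment: overlapping pairs and convergence to 1\<close>

text \<open>Chebyshev's inequality for the number \<open>X\<close> of distinct-entry solutions
  inside the random set, multiplied out to avoid dividing by the squared mean; only pairs sharing an
  entry contribute to the variance bound.\<close>

lemma second_moment:
  fixes n :: nat
  assumes "admissible M" "0 \<le> p" "p \<le> 1"
  defines "S \<equiv> distinct_solutions M n"
  shows "(1 - prob_nontrivial M n p) * (real (card S) * p ^ dim_col M)\<^sup>2 \<le>
    (\<Sum>x\<in>S. \<Sum>y\<in>S. of_bool (x ` {..<dim_col M} \<inter> y ` {..<dim_col M} \<noteq> {}) *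
       p ^ card (x ` {..<dim_col M} \<union> y ` {..<dim_col M}))"
proof -
  let ?m = "dim_col M" and ?N = "{1..int n}"
  let ?w = "set_weight n p"
  define T where "T = (\<lambda>x::nat \<Rightarrow> int. x ` {..<?m})"
  define X where "X = (\<lambda>A. \<Sum>x\<in>S. of_bool (T x \<subseteq> A) :: real)"
  define \<mu> where "\<mu> = real (card S) * p ^ ?m"
  have finS: "finite S" by (simp add: S_def finite_distinct_solutions)
  have T: "T x \<subseteq> ?N" "card (T x) = ?m" "finite (T x)" if "x \<in> S" for x
    using that by (auto simp: S_def distinct_solutions_def T_def card_image)
  have w: "0 \<le> ?w A" for A using set_weight_nonneg assms by blast
  have mean: "(\<Sum>A\<in>Pow ?N. ?w A * X A) = \<mu>"
  proof -
    have "(\<Sum>A\<in>Pow ?N. ?w A * X A) = (\<Sum>A\<in>Pow ?N. \<Sum>x\<in>S. of_bool (T x \<subseteq> A) * ?w A)"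
      unfolding X_def sum_distrib_left by (simp only: mult.commute)
    also have "\<dots> = (\<Sum>x\<in>S. \<Sum>A\<in>Pow ?N. of_bool (T x \<subseteq> A) * ?w A)" by (rule sum.swap)
    also have "\<dots> = (\<Sum>x\<in>S. p ^ ?m)"
      by (intro sum.cong refl) (subst sum_set_weight_superset, use T in auto)
    finally show ?thesis by (simp add: \<mu>_def)
  qed
  have square: "(\<Sum>A\<in>Pow ?N. ?w A * (X A)\<^sup>2) = (\<Sum>x\<in>S. \<Sum>y\<in>S. p ^ card (T x \<union> T y))"
  proof -
    have "?w A * (X A)\<^sup>2 = (\<Sum>x\<in>S. \<Sum>y\<in>S. of_bool (T x \<union> T y \<subseteq> A) * ?w A)" for A
    proof -
      have "(X A)\<^sup>2 = (\<Sum>x\<in>S. \<Sum>y\<in>S. of_bool (T x \<union> T y \<subseteq> A))"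
        unfolding X_def power2_eq_square sum_product by (intro sum.cong refl) auto
      then show ?thesis by (simp only: sum_distrib_left mult.commute)
    qed
    then have "(\<Sum>A\<in>Pow ?N. ?w A * (X A)\<^sup>2) =
        (\<Sum>A\<in>Pow ?N. \<Sum>x\<in>S. \<Sum>y\<in>S. of_bool (T x \<union> T y \<subseteq> A) * ?w A)" by simp
    also have "\<dots> = (\<Sum>x\<in>S. \<Sum>A\<in>Pow ?N. \<Sum>y\<in>S. of_bool (T x \<union> T y \<subseteq> A) * ?w A)"
      by (rule sum.swap)
    also have "\<dots> = (\<Sum>x\<in>S. \<Sum>y\<in>S. \<Sum>A\<in>Pow ?N. of_bool (T x \<union> T y \<subseteq> A) * ?w A)"
      by (intro sum.cong refl sum.swap)
    also have "\<dots> = (\<Sum>x\<in>S. \<Sum>y\<in>S. p ^ card (T x \<union> T y))"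
      by (intro sum.cong refl sum_set_weight_superset) (use T(1) in auto)
    finally show ?thesis .
  qed
  have zero: "X A = 0" if A: "A \<in> Pow ?N" "\<not> contains_nontrivial M A" for A
    unfolding X_def
  proof (rule sum.neutral, intro ballI)
    fix x assume x: "x \<in> S"
    have "\<not> T x \<subseteq> A"
    proof
      assume "T x \<subseteq> A"
      then have "\<forall>i<dim_col M. vec ?m x $ i \<in> A" by (auto simp: T_def)
      then have "contains_nontrivial M A"
        using nontrivial_of_distinct[OF assms(1)] x unfolding S_def contains_nontrivial_def by blast
      then show False using A(2) by simp
    qed
    then show "of_bool (T x \<subseteq> A) = (0::real)" by simp
  qed
  have "(1 - prob_nontrivial M n p) * \<mu>\<^sup>2 = (\<Sum>A\<in>Pow ?N. of_bool (\<not> contains_nontrivial M A) * ?w A) * \<mu>\<^sup>2"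
  proof -
    have "1 - prob_nontrivial M n p =
        (\<Sum>A\<in>Pow ?N. ?w A - of_bool (contains_nontrivial M A) * ?w A)"
      unfolding prob_nontrivial_eq sum_subtractf sum_set_weight ..
    also have "\<dots> = (\<Sum>A\<in>Pow ?N. of_bool (\<not> contains_nontrivial M A) * ?w A)"
      by (intro sum.cong) auto
    finally show ?thesis by simp
  qed
  \<comment> \<open>Without a nontrivial solution in \<open>A\<close> the count is 0 and the squared
    deviation is the squared mean; otherwise the left term is 0.\<close>
  also have "\<dots> \<le> (\<Sum>A\<in>Pow ?N. ?w A * (X A - \<mu>)\<^sup>2)"
    unfolding sum_distrib_right
  proof (rule sum_mono)
    fix A assume A: "A \<in> Pow ?N"
    show "of_bool (\<not> contains_nontrivial M A) * ?w A * \<mu>\<^sup>2 \<le> ?w A * (X A - \<mu>)\<^sup>2"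
      using zero[OF A] w[of A] by (cases "contains_nontrivial M A") auto
  qed
  also have "\<dots> = (\<Sum>A\<in>Pow ?N. ?w A * (X A)\<^sup>2 - 2 * \<mu> * (?w A * X A) + \<mu>\<^sup>2 * ?w A)"
    by (intro sum.cong) (auto simp: power2_eq_square algebra_simps)
  also have "\<dots> = (\<Sum>A\<in>Pow ?N. ?w A * (X A)\<^sup>2) - 2 * \<mu> * (\<Sum>A\<in>Pow ?N. ?w A * X A) + \<mu>\<^sup>2 * (\<Sum>A\<in>Pow ?N. ?w A)"
    by (simp add: sum.distrib sum_subtractf sum_distrib_left)
  also have "\<dots> = (\<Sum>x\<in>S. \<Sum>y\<in>S. p ^ card (T x \<union> T y)) - \<mu>\<^sup>2"
    unfolding mean square sum_set_weight by (simp add: power2_eq_square)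
  also have "\<dots> = (\<Sum>x\<in>S. \<Sum>y\<in>S. p ^ card (T x \<union> T y) - p ^ (2 * ?m))"
    by (simp add: sum_subtractf \<mu>_def power2_eq_square mult_2 power_add)
  \<comment> \<open>For disjoint pairs the union has 2 m elements and the term cancels; for the
    others the subtracted power is dropped.\<close>
  also have "\<dots> \<le> (\<Sum>x\<in>S. \<Sum>y\<in>S. of_bool (T x \<inter> T y \<noteq> {}) * p ^ card (T x \<union> T y))"
  proof (intro sum_mono)
    fix x y assume "x \<in> S" "y \<in> S"
    then show "p ^ card (T x \<union> T y) - p ^ (2 * ?m) \<le> of_bool (T x \<inter> T y \<noteq> {}) * p ^ card (T x \<union> T y)"
      using T assms(2) card_Un_disjoint[of "T x" "T y"] by (cases "T x \<inter> T y = {}") (auto simp: mult_2)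
  qed
  finally show ?thesis unfolding \<mu>_def T_def .
qed

text \<open>Overlapping pairs are classified by the set \<open>Q\<close> of positions of y whose
  entries occur in x and by a map \<open>g\<close> locating them in x. Given x, \<open>Q\<close> and
  \<open>g\<close>, the entries of y on \<open>Q\<close> are prescribed, so the fibre bound applies,
  and the union has 2 m - |Q| elements.\<close>

lemma overlap_sum_le:
  assumes "admissible M" "n > 0" "0 \<le> p"
  defines "S \<equiv> distinct_solutions M n" and "I \<equiv> {..<dim_col M}"
  shows "(\<Sum>x\<in>S. \<Sum>y\<in>S. of_bool (x ` I \<inter> y ` I \<noteq> {}) * p ^ card (x ` I \<union> y ` I)) \<le>
    (\<Sum>(Q, g) \<in> Sigma (Pow I - {{}}) (\<lambda>Q. Q \<rightarrow>\<^sub>E I). real (card S) *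
      real n powr (real (dim_col M) - real (dim_row M) - (real (card Q) - real_of_int (r_Q M Q))) *
      p ^ (2 * dim_col M - card Q))"
proof -
  let ?m = "dim_col M"
  let ?G = "Sigma (Pow I - {{}}) (\<lambda>Q. Q \<rightarrow>\<^sub>E I)"
  have finI: "finite I" by (simp add: I_def)
  have finS: "finite S" by (simp add: S_def finite_distinct_solutions)
  have finG: "finite ?G"
    using finI by (intro finite_SigmaI finite_PiE) (auto intro: finite_subset)
  have pair: "of_bool (x ` I \<inter> y ` I \<noteq> {}) * p ^ card (x ` I \<union> y ` I)
      \<le> (\<Sum>G\<in>?G. of_bool (\<forall>j\<in>fst G. y j = x (snd G j)) * p ^ (2 * ?m - card (fst G)))"
    if x: "x \<in> S" and y: "y \<in> S" for x y
  proof (cases "x ` I \<inter> y ` I = {}")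
    case True
    then show ?thesis using assms(3) by (auto intro!: sum_nonneg)
  next
    case False
    define Q where "Q = {j \<in> I. y j \<in> x ` I}"
    define g where "g = restrict (\<lambda>j. SOME i. i \<in> I \<and> y j = x i) Q"
    have inj: "inj_on x I" "inj_on y I" using x y by (auto simp: S_def I_def distinct_solutions_def)
    have g: "g j \<in> I \<and> y j = x (g j)" if "j \<in> Q" for j
    proof -
      have "\<exists>i. i \<in> I \<and> y j = x i" using that by (auto simp: Q_def)
      from someI_ex[OF this] show ?thesis using that by (simp add: g_def)
    qed
    have int: "x ` I \<inter> y ` I = y ` Q"
    proof -
      have "B \<inter> y ` I = y ` {j \<in> I. y j \<in> B}" for B by blast
      then show ?thesis by (simp add: Q_def)
    qed
    then have "Q \<noteq> {}" using False by auto
    moreover have "g \<in> Q \<rightarrow>\<^sub>E I" using g by (auto simp: g_def)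
    ultimately have G: "(Q, g) \<in> ?G" by (auto simp: Q_def)
    have "card (y ` Q) = card Q" by (rule card_image) (rule inj_on_subset[OF inj(2)], auto simp: Q_def)
    moreover have "card (x ` I \<union> y ` I) + card (x ` I \<inter> y ` I) = 2 * ?m"
      using card_Un_Int[of "x ` I" "y ` I"] finI inj by (simp add: card_image I_def)
    ultimately have "card (x ` I \<union> y ` I) = 2 * ?m - card Q" using int by simp
    then have "of_bool (x ` I \<inter> y ` I \<noteq> {}) * p ^ card (x ` I \<union> y ` I) =
        of_bool (\<forall>j\<in>fst (Q, g). y j = x (snd (Q, g) j)) * p ^ (2 * ?m - card (fst (Q, g)))"
      using False g by simp
    also have "\<dots> \<le> (\<Sum>G\<in>?G. of_bool (\<forall>j\<in>fst G. y j = x (snd G j)) * p ^ (2 * ?m - card (fst G)))"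
      by (rule member_le_sum[OF G _ finG]) (use assms(3) in auto)
    finally show ?thesis .
  qed
  have "(\<Sum>x\<in>S. \<Sum>y\<in>S. of_bool (x ` I \<inter> y ` I \<noteq> {}) * p ^ card (x ` I \<union> y ` I)) \<le>
     (\<Sum>x\<in>S. \<Sum>y\<in>S. \<Sum>G\<in>?G. of_bool (\<forall>j\<in>fst G. y j = x (snd G j)) * p ^ (2 * ?m - card (fst G)))"
    by (intro sum_mono pair)
  also have "\<dots> = (\<Sum>x\<in>S. \<Sum>G\<in>?G. \<Sum>y\<in>S. of_bool (\<forall>j\<in>fst G. y j = x (snd G j)) * p ^ (2 * ?m - card (fst G)))"
    by (intro sum.cong refl sum.swap)
  also have "\<dots> = (\<Sum>G\<in>?G. \<Sum>x\<in>S. \<Sum>y\<in>S. of_bool (\<forall>j\<in>fst G. y j = x (snd G j)) * p ^ (2 * ?m - card (fst G)))"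
    by (rule sum.swap)
  also have "\<dots> \<le> (\<Sum>G\<in>?G. \<Sum>x\<in>S. real n powr (real ?m - real (dim_row M) -
      (real (card (fst G)) - real_of_int (r_Q M (fst G)))) * p ^ (2 * ?m - card (fst G)))"
  proof (intro sum_mono)
    fix G x assume G: "G \<in> ?G"
    have "(\<Sum>y\<in>S. of_bool (\<forall>j\<in>fst G. y j = x (snd G j)) * p ^ (2 * ?m - card (fst G))) =
        real (card {y \<in> S. \<forall>j\<in>fst G. y j = x (snd G j)}) * p ^ (2 * ?m - card (fst G))"
      unfolding sum_distrib_right[symmetric] using finS by (simp add: Int_def)
    also have "\<dots> \<le> real n powr (real ?m - real (dim_row M) -
      (real (card (fst G)) - real_of_int (r_Q M (fst G)))) * p ^ (2 * ?m - card (fst G))"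
      unfolding S_def
      by (intro mult_right_mono card_distinct_solutions_fibre) (use G assms(2,3) in \<open>auto simp: I_def\<close>)
    finally show "(\<Sum>y\<in>S. of_bool (\<forall>j\<in>fst G. y j = x (snd G j)) * p ^ (2 * ?m - card (fst G))) \<le>
      real n powr (real ?m - real (dim_row M) -
      (real (card (fst G)) - real_of_int (r_Q M (fst G)))) * p ^ (2 * ?m - card (fst G))" .
  qed
  finally show ?thesis by (simp add: case_prod_unfold mult.assoc)
qed

lemma tendsto_1_above_threshold:
  assumes "admissible M" "dim_row M < dim_col M" "\<And>n. 0 \<le> p n \<and> p n \<le> 1"
    and "p \<in> \<omega>(\<lambda>n. real n powr (- 1 / cM M))"
  shows "(\<lambda>n. prob_nontrivial M n (p n)) \<longlonglongrightarrow> 1"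
proof -
  let ?m = "dim_col M" and ?I = "{..<dim_col M}"
  let ?d = "dim_col M - dim_row M"
  let ?G = "Sigma (Pow ?I - {{}}) (\<lambda>Q. Q \<rightarrow>\<^sub>E ?I)"
  obtain C where C: "C > 0"
    "\<And>n. n \<ge> C \<Longrightarrow> (real n / real C) ^ ?d \<le> real (card (distinct_solutions M n))"
    using card_distinct_solutions_ge[OF assms(1)] by blast
  \<comment> \<open>Neither the number of overlap types nor \<open>C\<close> depends on n.\<close>
  define N where "N = real (card ?G) * real C ^ ?d"
  have bound: "1 - prob_nontrivial M n (p n) \<le> N / t"
    if t: "t \<ge> 1" and n: "n \<ge> C" "t * real n powr (- 1 / cM M) \<le> p n" for t n
  proof -
    have n0: "n > 0" using n(1) C(1) by simp
    define s where "s = real (card (distinct_solutions M n))"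
    have p0: "p n > 0"
    proof -
      have "0 < t * real n powr (- 1 / cM M)" using t n0 by simp
      then show ?thesis using n(2) by linarith
    qed
    have nd: "real n powr (real ?m - real (dim_row M)) \<le> real C ^ ?d * s"
    proof -
      have "real n powr (real ?m - real (dim_row M)) = real n ^ ?d"
        using n0 assms(2) by (simp add: powr_realpow[symmetric] of_nat_diff)
      moreover have "real n ^ ?d = real C ^ ?d * (real n / real C) ^ ?d"
        using C(1) by (simp add: power_divide)
      ultimately show ?thesis using mult_left_mono[OF C(2)[OF n(1)], of "real C ^ ?d"] by (simp add: s_def)
    qed
    have s0: "s > 0"
    proof -
      have "0 < (real n / real C) ^ ?d" using n0 C(1) by simp
      then show ?thesis using C(2)[OF n(1)] unfolding s_def by linarith
    qed
    have single: "s * real n powr (real ?m - real (dim_row M) - (real (card Q) - real_of_int (r_Q M Q))) *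
        p n ^ (2 * ?m - card Q) \<le> real C ^ ?d / t * (s * p n ^ ?m)\<^sup>2"
      if Q: "Q \<subseteq> ?I" "Q \<noteq> {}" for Q
    proof -
      define q where "q = card Q"
      define e where "e = real (card Q) - real_of_int (r_Q M Q)"
      have finQ: "finite Q" using Q(1) finite_subset by blast
      have q: "q > 0" "q \<le> ?m" using Q finQ card_mono[OF _ Q(1)] by (auto simp: q_def card_gt_0_iff)
      have "1 / cM M \<le> e / real q" unfolding e_def q_def by (rule inverse_cM_le) (use assms(1) Q in auto)
      then have eq: "real q * (1 / cM M) \<le> e" using q by (simp add: field_simps)
      \<comment> \<open>The aim is that n^e p^q is at least \<open>t\<close>: p is at least
        \<open>t\<close> times the threshold, and q / c(M) \<le> e.\<close>
      have "t \<le> t ^ q" using t q power_increasing[of 1 q t] by simp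
      also have "\<dots> \<le> t ^ q * real n powr (e - real q * (1 / cM M))"
        using t n0 eq ge_one_powr_ge_zero[of "real n" "e - real q * (1 / cM M)"] by simp
      also have "\<dots> = real n powr e * (t * real n powr (- 1 / cM M)) ^ q"
        using n0 by (simp add: power_mult_distrib powr_power powr_diff powr_minus field_simps)
      also have "\<dots> \<le> real n powr e * p n ^ q"
        by (intro mult_left_mono power_mono) (use n t in auto)
      finally have te: "t \<le> real n powr e * p n ^ q" .
      have "t * (s * real n powr (real ?m - real (dim_row M) - e) * p n ^ (2 * ?m - q))
         \<le> (real n powr e * p n ^ q) * (s * real n powr (real ?m - real (dim_row M) - e) * p n ^ (2 * ?m - q))"
        using te s0 p0 by (intro mult_right_mono) auto
      also have "\<dots> = s * (real n powr e * real n powr (real ?m - real (dim_row M) - e)) * (p n ^ q * p n ^ (2 * ?m - q))"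
        by (simp only: mult_ac)
      also have "real n powr e * real n powr (real ?m - real (dim_row M) - e) = real n powr (real ?m - real (dim_row M))"
        by (simp flip: powr_add)
      also have "p n ^ q * p n ^ (2 * ?m - q) = p n ^ (2 * ?m)" using q(2) by (simp flip: power_add)
      \<comment> \<open>One power n^(m - r) is traded for a constant times \<open>s\<close>, which
        produces the squared mean.\<close>
      also have "s * real n powr (real ?m - real (dim_row M)) * p n ^ (2 * ?m) \<le> s * (real C ^ ?d * s) * p n ^ (2 * ?m)"
        using nd s0 p0 by (intro mult_right_mono mult_left_mono) auto
      also have "\<dots> = real C ^ ?d * (s * p n ^ ?m)\<^sup>2"
        by (simp add: power2_eq_square mult_2 power_add)
      finally show ?thesis using t by (simp add: e_def q_def field_simps)
    qed
    have "(1 - prob_nontrivial M n (p n)) * (s * p n ^ ?m)\<^sup>2 \<le>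
       (\<Sum>(Q, g) \<in> ?G. s * real n powr (real ?m - real (dim_row M) - (real (card Q) - real_of_int (r_Q M Q))) *
        p n ^ (2 * ?m - card Q))"
      unfolding s_def
      by (rule order_trans[OF second_moment[OF assms(1)] overlap_sum_le[OF assms(1) n0]]) (use assms(3) in auto)
    also have "\<dots> \<le> (\<Sum>(Q, g) \<in> ?G. real C ^ ?d / t * (s * p n ^ ?m)\<^sup>2)"
      using single by (intro sum_mono) auto
    also have "\<dots> = N / t * (s * p n ^ ?m)\<^sup>2" by (simp add: N_def)
    finally have "(1 - prob_nontrivial M n (p n)) * (s * p n ^ ?m)\<^sup>2 \<le> N / t * (s * p n ^ ?m)\<^sup>2" .
    moreover have "0 < (s * p n ^ ?m)\<^sup>2" using s0 p0 by simp
    ultimately show ?thesis by (rule mult_right_le_imp_le)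
  qed
  have le1: "prob_nontrivial M n (p n) \<le> 1" for n
    unfolding prob_nontrivial_eq sum_set_weight[of n "p n", symmetric]
    using set_weight_nonneg[of "p n" n] assms(3)[of n] by (intro sum_mono) auto
  show ?thesis
  proof (rule LIMSEQ_I)
    fix u :: real assume u: "0 < u"
    \<comment> \<open>With this choice N / t \<le> N u / (N + 1) < u.\<close>
    define t where "t = max 1 ((N + 1) / u)"
    have N0: "N \<ge> 0" by (simp add: N_def)
    have t: "t \<ge> 1" "(N + 1) / u \<le> t" by (auto simp: t_def)
    then have Nt: "N / t < u" using u by (simp add: field_simps)
    have "eventually (\<lambda>n. norm (p n) \<ge> t * norm (real n powr (- 1 / cM M))) sequentially"
      using landau_omega.smallD[OF assms(4), of t] t by simp
    then have "eventually (\<lambda>n. norm (prob_nontrivial M n (p n) - 1) < u) sequentially"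
      using eventually_ge_at_top[of C]
    proof eventually_elim
      case (elim n)
      then have "t * real n powr (- 1 / cM M) \<le> p n" using assms(3)[of n] by simp
      then show ?case using bound[OF t(1) elim(2)] Nt le1[of n] by simp
    qed
    then show "\<exists>no. \<forall>n\<ge>no. norm (prob_nontrivial M n (p n) - 1) < u"
      by (simp add: eventually_sequentially)
  qed
qed

theorem theorem1p2:
  fixes M :: "int mat" and r m :: nat
  assumes "0 < r" and "r < m" and "M \<in> carrier_mat r m" and "admissible M"
  shows "(\<forall>p :: nat \<Rightarrow> real. (\<forall>n. 0 \<le> p n \<and> p n \<le> 1) \<longrightarrow>
            p \<in> o(\<lambda>n. real n powr (- 1 / cM M)) \<longrightarrow>
            (\<lambda>n. prob_nontrivial M n (p n)) \<longlonglongrightarrow> 0)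
       \<and> (\<forall>p :: nat \<Rightarrow> real. (\<forall>n. 0 \<le> p n \<and> p n \<le> 1) \<longrightarrow>
            p \<in> \<omega>(\<lambda>n. real n powr (- 1 / cM M)) \<longrightarrow>
            (\<lambda>n. prob_nontrivial M n (p n)) \<longlonglongrightarrow> 1)"
proof -
  have "dim_col M > 0" "dim_row M < dim_col M" using assms(2,3) by auto
  then show ?thesis
    using tendsto_0_below_threshold[OF assms(4)] tendsto_1_above_threshold[OF assms(4)] by blast
qed

end
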